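(* Let $G$ be a forest on the vertex set $\{x_1,\ldots,x_n\}$ and let $NI(G)\subseteq R=\mathbf{k}[x_1,\ldots,x_n]$ be its closed neighborhood ideal. Then $\operatorname{reg}(R/NI(G))\geq a_G$ and $\operatorname{pd}(R/NI(G))\geq a_G$.
   Context: $\mathbf{k}$ is a field, vertices are identified with variables, and $R$ is standard graded. $N[x_i]=\{x_i\}\cup\{x_j:\{x_i,x_j\}\in E(G)\}$ and $NI(G)=\langle \prod_{x_j\in N[x_i]}x_j : x_i\in V(G)\rangle$. $a_G$ denotes the matching number of $G$, i.e. the maximum number of pairwise disjoint edges of $G$. $\operatorname{reg}$ is Castelnuovo–Mumford regularity and $\operatorname{pd}$ is projective dimension over $R$. *)

theory Defs
  imports Main "HOL-Library.Poly_Mapping"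
begin

text \<open>Polynomial ring k[x_v : v in 'v] over a field k, variables indexed by a finite type 'v
  (the vertex set of the graph). A monomial is an exponent vector 'v =>0 nat,
  a polynomial is a finitely supported map from monomials to coefficients.\<close>

type_synonym ('v, 'k) mpoly = "('v \<Rightarrow>\<^sub>0 nat) \<Rightarrow>\<^sub>0 'k"

definition mon_deg :: "('v \<Rightarrow>\<^sub>0 nat) \<Rightarrow> nat" where
  "mon_deg m = (\<Sum>v\<in>Poly_Mapping.keys m. Poly_Mapping.lookup m v)"

text \<open>p is homogeneous of (integer) degree e (the zero polynomial is homogeneous of every degree).\<close>
definition homog :: "int \<Rightarrow> ('v, 'k::zero) mpoly \<Rightarrow> bool" where
  "homog e p \<longleftrightarrow> (\<forall>m\<in>Poly_Mapping.keys p. int (mon_deg m) = e)"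

definition simple_graph :: "'v set set \<Rightarrow> bool" where
  "simple_graph E \<longleftrightarrow> (\<forall>e\<in>E. card e = 2)"

definition is_cycle :: "'v set set \<Rightarrow> 'v list \<Rightarrow> bool" where
  "is_cycle E vs \<longleftrightarrow> distinct vs \<and> length vs \<ge> 3 \<and>
     (\<forall>i. Suc i < length vs \<longrightarrow> {vs ! i, vs ! Suc i} \<in> E) \<and> {last vs, hd vs} \<in> E"

definition forest :: "'v set set \<Rightarrow> bool" where
  "forest E \<longleftrightarrow> simple_graph E \<and> \<not> (\<exists>vs. is_cycle E vs)"

definition matching_number :: "'v set set \<Rightarrow> nat" where
  "matching_number E = Max {card M | M. M \<subseteq> E \<and> (\<forall>e\<in>M. \<forall>f\<in>M. e \<noteq> f \<longrightarrow> e \<inter> f = {})}"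

definition closed_nbhd :: "'v set set \<Rightarrow> 'v \<Rightarrow> 'v set" where
  "closed_nbhd E i = insert i {j. {i, j} \<in> E}"

definition var_prod :: "'v set \<Rightarrow> ('v::finite, 'k::field) mpoly" where
  "var_prod S = Poly_Mapping.single (\<Sum>j\<in>S. Poly_Mapping.single j (1::nat)) (1::'k)"

definition NI :: "'v::finite set set \<Rightarrow> ('v, 'k::field) mpoly set" where
  "NI E = {\<Sum>i\<in>UNIV. c i * var_prod (closed_nbhd E i) | c. True}"

definition free_mod :: "nat \<Rightarrow> (nat \<Rightarrow> 'r::zero) set" where
  "free_mod b = {v. \<forall>c\<ge>b. v c = 0}"

definition mat_app :: "nat \<Rightarrow> (nat \<Rightarrow> nat \<Rightarrow> 'r::comm_semiring_0) \<Rightarrow> (nat \<Rightarrow> 'r) \<Rightarrow> nat \<Rightarrow> 'r" where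
  "mat_app b A v = (\<lambda>r. \<Sum>c<b. A r c * v c)"

text \<open>A graded free resolution
  ... -> F_2 -> F_1 -> F_0 = R -> R/I -> 0 of finite length,
  F_i = (+)_{c < b i} R(- d i c), the map F_i -> F_(i-1) given by the matrix A i
  (entry (r,c) homogeneous of degree d i c - d (i-1) r).\<close>
definition graded_free_res ::
  "('v::finite, 'k::field) mpoly set \<Rightarrow> (nat \<Rightarrow> nat) \<Rightarrow> (nat \<Rightarrow> nat \<Rightarrow> int)
     \<Rightarrow> (nat \<Rightarrow> nat \<Rightarrow> nat \<Rightarrow> ('v, 'k) mpoly) \<Rightarrow> bool" where
  "graded_free_res I b d A \<longleftrightarrow>
     b 0 = 1 \<and> d 0 0 = 0 \<and>
     (\<forall>i\<ge>1. \<forall>r c. (r \<ge> b (i - 1) \<or> c \<ge> b i) \<longrightarrow> A i r c = 0) \<and>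
     (\<forall>i\<ge>1. \<forall>r<b (i - 1). \<forall>c<b i. homog (d i c - d (i - 1) r) (A i r c)) \<and>
     {mat_app (b 1) (A 1) v 0 | v. v \<in> free_mod (b 1)} = I \<and>
     (\<forall>i\<ge>1. {v \<in> free_mod (b i). mat_app (b i) (A i) v = (\<lambda>_. 0)}
              = mat_app (b (Suc i)) (A (Suc i)) ` free_mod (b (Suc i))) \<and>
     (\<exists>p. \<forall>i>p. b i = 0)"

definition minimal_graded_free_res ::
  "('v::finite, 'k::field) mpoly set \<Rightarrow> (nat \<Rightarrow> nat) \<Rightarrow> (nat \<Rightarrow> nat \<Rightarrow> int)
     \<Rightarrow> (nat \<Rightarrow> nat \<Rightarrow> nat \<Rightarrow> ('v, 'k) mpoly) \<Rightarrow> bool" where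
  "minimal_graded_free_res I b d A \<longleftrightarrow>
     graded_free_res I b d A \<and> (\<forall>i\<ge>1. \<forall>r c. Poly_Mapping.lookup (A i r c) 0 = 0)"

definition res_length :: "(nat \<Rightarrow> nat) \<Rightarrow> nat" where
  "res_length b = (LEAST p. \<forall>i>p. b i = 0)"

definition res_reg :: "(nat \<Rightarrow> nat) \<Rightarrow> (nat \<Rightarrow> nat \<Rightarrow> int) \<Rightarrow> int" where
  "res_reg b d = Max {d i c - int i | i c. c < b i}"

text \<open>pd(R/I) and reg(R/I), read off from the (unique up to isomorphism) minimal graded
  free resolution: pd = its length, reg = max { j - i : beta_{i,j} <> 0 }.\<close>
definition proj_dim_quot :: "('v::finite, 'k::field) mpoly set \<Rightarrow> nat" where
  "proj_dim_quot I = (SOME p. \<exists>b d A. minimal_graded_free_res I b d A \<and> p = res_length b)"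

definition reg_quot :: "('v::finite, 'k::field) mpoly set \<Rightarrow> int" where
  "reg_quot I = (SOME r. \<exists>b d A. minimal_graded_free_res I b d A \<and> r = res_reg b d)"

end

theory Submission
  imports Defs HOL.Vector_Spaces "HOL-Library.Function_Algebras"
begin

text \<open>A forest has a matching of maximum size with edges {x, y x} for x in X such that every neighbor of a
  vertex of X lies in y ` X: repeatedly choose a leaf x and its neighbor y x, and delete y x. Let
  a = card X. The element (product of the y x) e_X of the Koszul complex is a cycle over R/NI(G) which is
  not a boundary, so Tor_a(R/NI(G), k) is nonzero in degree 2a. Hence every graded free resolution has a
  generator of degree 2a in homological degree a, and both inequalities follow. A minimal resolution
  exists because it can be built over the field, one squarefree multidegree at a time.\<close>

subsection \<open>Matchings in forests\<close>

text \<open>Regularity and projective dimension are read off from a minimal resolution picked by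
  \<open>SOME\<close>, so a lower bound takes two facts: the bound for every minimal resolution and
  the existence of one. The condition on the neighbors of X is what makes the element a cycle: with
  Y the set of the y x, each term of its boundary has coefficient x_v times the product over Y, up
  to sign, for some v in X, and the closed neighborhood of v lies in {v} \<union> Y. One generator
  serves both inequalities, since in homological degree a it contributes 2a - a = a to the
  regularity. Membership of a monomial in NI(G) depends only on its support. Hence both the
  nonvanishing of the class and the construction of the resolution become, in each multidegree,
  linear algebra over k indexed by subsets of the vertex set.\<close>

lemma forest_has_leaf:
  fixes E :: "'v::finite set set"
  assumes "forest E" "E \<noteq> {}"
  obtains x y where "{x, y} \<in> E" "x \<noteq> y" "\<And>e. e \<in> E \<Longrightarrow> x \<in> e \<Longrightarrow> e = {x, y}"
proof -
  define path where "path vs \<longleftrightarrow> distinct vs \<and> vs \<noteq> [] \<and>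
    (\<forall>i. Suc i < length vs \<longrightarrow> {vs ! i, vs ! Suc i} \<in> E)" for vs :: "'v list"
  have card2: "card e = 2" if "e \<in> E" for e
    using assms(1) that unfolding forest_def simple_graph_def by blast
  obtain e where "e \<in> E" using assms(2) by blast
  then obtain p q where pq: "{p, q} \<in> E" "p \<noteq> q" using card2 by (metis card_2_iff)
  have path0: "path [p, q]" using pq unfolding path_def by (auto simp: less_Suc_eq)
  have bound: "\<forall>vs. path vs \<longrightarrow> length vs < Suc (card (UNIV :: 'v set))"
    by (metis card_mono distinct_card finite less_Suc_eq_le path_def subset_UNIV)
  \<comment> \<open>The leaf is the first vertex of a longest path: a neighbor outside the path
    would extend it, and one further along than the second vertex would close a cycle.\<close>
  obtain vs where vs: "path vs" and max: "\<And>ws. path ws \<Longrightarrow> length ws \<le> length vs"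
    using ex_has_greatest_nat[of path "[p, q]" length "Suc (card (UNIV :: 'v set))", OF path0] bound
    by (metis order_less_imp_le)
  have len: "length vs \<ge> 2" using max[OF path0] by simp
  have nb: "j = vs ! 1" if j: "{vs ! 0, j} \<in> E" for j
  proof -
    have ne: "vs ! 0 \<noteq> j" using card2[OF j] by auto
    have "j \<in> set vs"
    proof (rule ccontr)
      assume "j \<notin> set vs"
      then have "path (j # vs)" using vs j unfolding path_def
        by (auto simp: nth_Cons insert_commute split: nat.split)
      from max[OF this] show False by simp
    qed
    then obtain i where i: "i < length vs" "vs ! i = j" by (meson in_set_conv_nth)
    have "i \<noteq> 0" using ne i by metis
    moreover have "\<not> i \<ge> 2"
    proof
      assume i2: "i \<ge> 2"
      have "vs \<noteq> []" using len by auto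
      \<comment> \<open>The prefix ending in \<open>j\<close> has \<open>Suc i\<close> \<ge> 3
        vertices, and the edge from \<open>j\<close> back to the first vertex closes it.\<close>
      have "is_cycle E (take (Suc i) vs)" unfolding is_cycle_def
      proof (intro conjI allI impI)
        show "distinct (take (Suc i) vs)" using vs unfolding path_def by simp
        show "3 \<le> length (take (Suc i) vs)" using i i2 by simp
        show "{take (Suc i) vs ! k, take (Suc i) vs ! Suc k} \<in> E"
          if "Suc k < length (take (Suc i) vs)" for k
          using vs that unfolding path_def by simp
        have "last (take (Suc i) vs) = j" using i by (simp add: take_Suc_conv_app_nth)
        moreover have "hd (take (Suc i) vs) = vs ! 0" using \<open>vs \<noteq> []\<close> by (simp add: hd_conv_nth)
        ultimately show "{last (take (Suc i) vs), hd (take (Suc i) vs)} \<in> E"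
          using j by (simp add: insert_commute)
      qed
      then show False using assms(1) unfolding forest_def by blast
    qed
    ultimately have "i = 1" by simp
    then show ?thesis using i by simp
  qed
  show thesis
  proof
    show xy: "{vs ! 0, vs ! 1} \<in> E" using vs len unfolding path_def by auto
    show "vs ! 0 \<noteq> vs ! 1" using card2[OF xy] by auto
    show "e = {vs ! 0, vs ! 1}" if e: "e \<in> E" "vs ! 0 \<in> e" for e
    proof -
      obtain u v where "e = {u, v}" "u \<noteq> v" using card2[OF e(1)] by (metis card_2_iff)
      then obtain j where "e = {vs ! 0, j}" using e(2) by auto
      then show ?thesis using nb e(1) by metis
    qed
  qed
qed

lemma forest_mono: "forest E \<Longrightarrow> E' \<subseteq> E \<Longrightarrow> forest E'"
  unfolding forest_def simple_graph_def is_cycle_def by blast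

text \<open>For a maximum matching of a bipartite graph, such a labelling of the ends comes from a minimum
  vertex cover (Koenig's theorem), the ends y x being those in the cover.\<close>
definition koenig_matching :: "'v set set \<Rightarrow> 'v set \<Rightarrow> ('v \<Rightarrow> 'v) \<Rightarrow> bool" where
  "koenig_matching E X y \<longleftrightarrow> inj_on y X \<and> y ` X \<inter> X = {} \<and> (\<forall>x\<in>X. {x, y x} \<in> E) \<and>
     (\<forall>x\<in>X. \<forall>j. {x, j} \<in> E \<longrightarrow> j \<in> y ` X)"

text \<open>Induction by deleting the neighbor \<open>z\<close> of a leaf \<open>x\<close>. This
  removes at most one edge of \<open>M\<close> and isolates \<open>x\<close>, so the edge {x, z} can
  be added to what the induction gives; an edge lost at some \<open>u\<close> of the old
  \<open>X\<close> leads to \<open>z\<close>, which is now a partner.\<close>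

lemma koenig_matching_exists:
  fixes E :: "'v::finite set set"
  assumes "forest E" "M \<subseteq> E" "\<forall>e\<in>M. \<forall>f\<in>M. e \<noteq> f \<longrightarrow> e \<inter> f = {}"
  shows "\<exists>X y. koenig_matching E X y \<and> card M \<le> card X"
  using assms
proof (induction "card E" arbitrary: E M rule: less_induct)
  case less
  show ?case
  proof (cases "E = {}")
    case True
    then have "M = {}" using less.prems by blast
    then show ?thesis by (intro exI[of _ "{}"]) (auto simp: koenig_matching_def)
  next
    case False
    then obtain x z where xz: "{x, z} \<in> E" "x \<noteq> z"
      and leaf: "\<And>e. e \<in> E \<Longrightarrow> x \<in> e \<Longrightarrow> e = {x, z}"
      using forest_has_leaf less.prems(1) by metis
    define E' where "E' = {e \<in> E. z \<notin> e}"
    define M' where "M' = {e \<in> M. z \<notin> e}"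
    have "E' \<subset> E" using xz unfolding E'_def by blast
    then have "card E' < card E" by (simp add: psubset_card_mono)
    moreover have "forest E'" by (rule forest_mono[OF less.prems(1)]) (simp add: E'_def)
    moreover have "M' \<subseteq> E'" using less.prems(2) unfolding M'_def E'_def by blast
    moreover have "\<forall>e\<in>M'. \<forall>f\<in>M'. e \<noteq> f \<longrightarrow> e \<inter> f = {}"
      using less.prems(3) unfolding M'_def by blast
    ultimately obtain X y where K: "koenig_matching E' X y" and cX: "card M' \<le> card X"
      using less.hyps[of E' M'] by metis
    have E'z: "z \<notin> e" and E'x: "x \<notin> e" if "e \<in> E'" for e
      using that leaf unfolding E'_def by auto
    have ed: "{u, y u} \<in> E'" if "u \<in> X" for u using K that unfolding koenig_matching_def by blast
    have xX: "x \<notin> X" "z \<notin> X" "x \<notin> y ` X" "z \<notin> y ` X" using ed E'z E'x by fastforce+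
    have im: "(y(x := z)) ` insert x X = insert z (y ` X)" using xX by auto
    have "koenig_matching E (insert x X) (y(x := z))"
      unfolding koenig_matching_def im
    proof (intro conjI ballI allI impI)
      show "inj_on (y(x := z)) (insert x X)"
        using K xX unfolding koenig_matching_def inj_on_def by auto
      show "insert z (y ` X) \<inter> insert x X = {}"
        using K xX xz unfolding koenig_matching_def by auto
      show "{u, (y(x := z)) u} \<in> E" if "u \<in> insert x X" for u
        using that ed xz unfolding E'_def by auto
      show "j \<in> insert z (y ` X)" if "u \<in> insert x X" "{u, j} \<in> E" for u j
      proof (cases "u = x")
        case True
        then show ?thesis using leaf[OF that(2)] xz by (auto simp: doubleton_eq_iff)
      next
        case False
        then have "u \<in> X" using that by simp
        show ?thesis
        proof (cases "j = z")
          case False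
          then have "{u, j} \<in> E'" using that \<open>u \<in> X\<close> xX unfolding E'_def by auto
          then show ?thesis using K \<open>u \<in> X\<close> unfolding koenig_matching_def by blast
        qed simp
      qed
    qed
    moreover have "card M \<le> card (insert x X)"
    proof -
      \<comment> \<open>All edges in the difference contain \<open>z\<close>, and distinct edges of
        \<open>M\<close> are disjoint.\<close>
      have "card (M - M') \<le> 1"
        unfolding card_le_Suc0_iff_eq[OF finite, folded One_nat_def] M'_def using less.prems(3) by blast
      moreover have "card M = card M' + card (M - M')"
        using card_Un_disjoint[of M' "M - M'"] by (simp add: M'_def Un_absorb1)
      ultimately show ?thesis using cX xX by simp
    qed
    ultimately show ?thesis by blast
  qed
qed

lemma koenig_matching_number:
  fixes E :: "'v::finite set set"
  assumes "forest E"
  obtains X y where "koenig_matching E X y" "matching_number E \<le> card X"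
proof -
  define C where "C = {card M | M. M \<subseteq> E \<and> (\<forall>e\<in>M. \<forall>f\<in>M. e \<noteq> f \<longrightarrow> e \<inter> f = {})}"
  have "C \<subseteq> range (card :: 'v set set \<Rightarrow> nat)" unfolding C_def by auto
  then have "finite C" by (rule finite_subset) simp
  moreover have "card ({} :: 'v set set) \<in> C"
    unfolding C_def by (intro CollectI exI[of _ "{}"]) simp
  ultimately have "Max C \<in> C" by (intro Max_in) auto
  then obtain M where M: "Max C = card M" "M \<subseteq> E" "\<forall>e\<in>M. \<forall>f\<in>M. e \<noteq> f \<longrightarrow> e \<inter> f = {}"
    unfolding C_def by auto
  obtain X y where "koenig_matching E X y" "card M \<le> card X"
    using koenig_matching_exists[OF assms M(2,3)] by auto
  then show thesis using that M(1) unfolding matching_number_def C_def by metis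
qed

subsection \<open>Squarefree shifts and homogeneous polynomials\<close>

definition ind :: "'v set \<Rightarrow> 'v \<Rightarrow>\<^sub>0 nat" where
  "ind S = (\<Sum>j\<in>S. Poly_Mapping.single j 1)"

lemma var_prod_ind: "var_prod S = Poly_Mapping.single (ind S) 1"
  by (simp add: var_prod_def ind_def)

lemma lookup_ind: "Poly_Mapping.lookup (ind (S :: 'v::finite set)) v = (if v \<in> S then 1 else 0)"
  by (simp add: ind_def lookup_sum lookup_single when_def)

lemma keys_ind [simp]: "Poly_Mapping.keys (ind (S :: 'v::finite set)) = S"
  by (auto simp: in_keys_iff lookup_ind split: if_splits)

lemma ind_Un: "S \<inter> T = {} \<Longrightarrow> ind (S \<union> T) = ind S + ind (T :: 'v::finite set)"
  by (rule poly_mapping_eqI) (auto simp: lookup_add lookup_ind)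

lemma mon_deg_sum: "mon_deg (m :: 'v::finite \<Rightarrow>\<^sub>0 nat) = (\<Sum>v\<in>UNIV. Poly_Mapping.lookup m v)"
  unfolding mon_deg_def by (rule sum.mono_neutral_left) (auto simp: in_keys_iff)

lemma mon_deg_add: "mon_deg (m + n) = mon_deg m + mon_deg (n :: 'v::finite \<Rightarrow>\<^sub>0 nat)"
  by (simp add: mon_deg_sum lookup_add sum.distrib)

lemma mon_deg_ind: "mon_deg (ind S) = card (S :: 'v::finite set)"
  by (simp add: mon_deg_sum lookup_ind sum.If_cases)

lemma mon_deg_zero [simp]: "mon_deg 0 = 0"
  by (simp add: mon_deg_def)

text \<open>Exponents are subtracted with truncation at 0, so divisibility by the monomial has to be
  a separate condition; for a squarefree monomial it only concerns the support of \<mu>.\<close>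

lemma lookup_single_ind_mult:
  fixes p :: "('v::finite, 'k::field) mpoly"
  shows "Poly_Mapping.lookup (Poly_Mapping.single (ind S) \<beta> * p) \<mu> =
    (if S \<subseteq> Poly_Mapping.keys \<mu> then \<beta> * Poly_Mapping.lookup p (\<mu> - ind S) else 0)"
proof -
  have "Poly_Mapping.lookup (Poly_Mapping.single (ind S) \<beta> * p) \<mu> =
    \<beta> * (\<Sum>q. Poly_Mapping.lookup p q when \<mu> = ind S + q)"
    by (simp add: lookup_mult lookup_single when_mult)
  moreover have "\<mu> = ind S + q \<longleftrightarrow> S \<subseteq> Poly_Mapping.keys \<mu> \<and> \<mu> - ind S = q" for q
  proof
    assume "\<mu> = ind S + q"
    then show "S \<subseteq> Poly_Mapping.keys \<mu> \<and> \<mu> - ind S = q"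
      by (auto simp: in_keys_iff lookup_add lookup_ind)
  next
    assume "S \<subseteq> Poly_Mapping.keys \<mu> \<and> \<mu> - ind S = q"
    then show "\<mu> = ind S + q"
      by (intro poly_mapping_eqI)
        (auto simp: lookup_add lookup_minus lookup_ind in_keys_iff subset_iff)
  qed
  ultimately show ?thesis by simp
qed

text \<open>The coefficient of degree \<mu> of the element p of the shifted module R(-S), in which the
  generator has squarefree multidegree S.\<close>
definition mcoeff :: "'v::finite set \<Rightarrow> ('v, 'k::field) mpoly \<Rightarrow> ('v \<Rightarrow>\<^sub>0 nat) \<Rightarrow> 'k" where
  "mcoeff S p \<mu> = Poly_Mapping.lookup (Poly_Mapping.single (ind S) 1 * p) \<mu>"

lemma mcoeff_eq:
  "mcoeff S p \<mu> = (if S \<subseteq> Poly_Mapping.keys \<mu> then Poly_Mapping.lookup p (\<mu> - ind S) else 0)"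
  by (simp add: mcoeff_def lookup_single_ind_mult)

lemma mcoeff_zero [simp]: "mcoeff S 0 \<mu> = 0"
  by (simp add: mcoeff_def)

lemma mcoeff_sum: "mcoeff S (sum f A) \<mu> = (\<Sum>i\<in>A. mcoeff S (f i) \<mu>)"
  by (simp add: mcoeff_def sum_distrib_left lookup_sum)

lemma mcoeff_diff: "mcoeff S (p - q) \<mu> = mcoeff S p \<mu> - mcoeff S q \<mu>"
  by (simp add: mcoeff_def right_diff_distrib lookup_minus)

text \<open>A matrix entry \<beta> x^(S - S') from a generator of multidegree \<open>S\<close> to
  one of multidegree \<open>S'\<close> acts in every multidegree as the scalar \<beta>. This turns
  polynomial matrices into matrices over the field.\<close>

lemma mcoeff_mult:
  assumes "S' \<subseteq> S"
  shows "mcoeff S' (Poly_Mapping.single (ind (S - S')) \<beta> * p) \<mu> = \<beta> * mcoeff S p \<mu>"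
proof -
  have "ind S = ind S' + ind (S - S')" using assms ind_Un[of S' "S - S'"] by (simp add: Un_absorb1)
  then have "Poly_Mapping.single (ind S') 1 * (Poly_Mapping.single (ind (S - S')) \<beta> * p) =
    Poly_Mapping.single (ind S) \<beta> * p"
    by (simp add: mult.assoc[symmetric] mult_single)
  then show ?thesis by (simp add: mcoeff_def lookup_single_ind_mult)
qed

lemma lookup_eq_mcoeff: "Poly_Mapping.lookup p \<nu> = mcoeff S p (\<nu> + ind S)"
  by (auto simp: mcoeff_eq in_keys_iff lookup_add lookup_ind)

lemma mcoeff_ext: "(\<And>\<mu>. mcoeff S p \<mu> = mcoeff S q \<mu>) \<Longrightarrow> p = q"
  by (rule poly_mapping_eqI) (simp add: lookup_eq_mcoeff[where S = S])

lemma finite_mcoeff: "finite {\<mu>. mcoeff S p \<mu> \<noteq> 0}"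
  by (simp add: mcoeff_def)

text \<open>The way back from scalars to polynomials: choices made independently in each multidegree
  assemble to a polynomial as soon as only finitely many are nonzero.\<close>

lemma mcoeff_realize:
  fixes t :: "('v::finite \<Rightarrow>\<^sub>0 nat) \<Rightarrow> 'k::field"
  assumes "finite {\<mu>. t \<mu> \<noteq> 0}" "\<And>\<mu>. t \<mu> \<noteq> 0 \<Longrightarrow> S \<subseteq> Poly_Mapping.keys \<mu>"
  obtains p where "\<And>\<mu>. mcoeff S p \<mu> = t \<mu>"
proof
  let ?p = "Abs_poly_mapping (\<lambda>\<nu>. t (\<nu> + ind S))"
  have "finite ((\<lambda>\<nu>. \<nu> + ind S) -` {\<mu>. t \<mu> \<noteq> 0})"
    by (rule finite_vimageI[OF assms(1)]) (simp add: inj_def)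
  then have l: "Poly_Mapping.lookup ?p \<nu> = t (\<nu> + ind S)" for \<nu> by (simp add: vimage_def)
  show "mcoeff S ?p \<mu> = t \<mu>" for \<mu>
  proof (cases "S \<subseteq> Poly_Mapping.keys \<mu>")
    case True
    then have "\<mu> - ind S + ind S = \<mu>"
      by (intro poly_mapping_eqI) (auto simp: lookup_add lookup_minus lookup_ind in_keys_iff subset_iff)
    then show ?thesis using True by (simp add: mcoeff_eq l)
  next
    case False
    then show ?thesis using assms(2) by (auto simp: mcoeff_eq)
  qed
qed

section \<open>Homogeneous polynomials and homogeneous components\<close>

lemma homog_zero [simp]: "homog e 0"
  by (simp add: homog_def)

lemma homog_single: "homog (int (mon_deg m)) (Poly_Mapping.single m \<beta>)"
  by (cases "\<beta> = 0") (simp_all add: homog_def)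

lemma homog_mult:
  fixes p q :: "('v::finite, 'k::field) mpoly"
  assumes "homog e p" "homog f q"
  shows "homog (e + f) (p * q)"
  unfolding homog_def
proof
  fix m assume "m \<in> Poly_Mapping.keys (p * q)"
  then obtain k l where "m = k + l" "k \<in> Poly_Mapping.keys p" "l \<in> Poly_Mapping.keys q"
    using keys_mult[of p q] by blast
  then show "int (mon_deg m) = e + f" using assms by (simp add: homog_def mon_deg_add)
qed

lemma homog_sum:
  fixes f :: "'a \<Rightarrow> ('v, 'k::field) mpoly"
  assumes "\<And>i. i \<in> A \<Longrightarrow> homog e (f i)"
  shows "homog e (sum f A)"
  unfolding homog_def
proof
  fix m assume "m \<in> Poly_Mapping.keys (sum f A)"
  then have "(\<Sum>i\<in>A. Poly_Mapping.lookup (f i) m) \<noteq> 0" by (simp add: in_keys_iff lookup_sum)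
  then obtain i where "i \<in> A" "m \<in> Poly_Mapping.keys (f i)"
    by (auto simp: in_keys_iff elim: sum.not_neutral_contains_not_neutral)
  then show "int (mon_deg m) = e" using assms by (simp add: homog_def)
qed

definition hcomp :: "int \<Rightarrow> ('v, 'k::field) mpoly \<Rightarrow> ('v, 'k) mpoly" where
  "hcomp e p = Abs_poly_mapping (\<lambda>m. if int (mon_deg m) = e then Poly_Mapping.lookup p m else 0)"

lemma lookup_hcomp:
  "Poly_Mapping.lookup (hcomp e p) m = (if int (mon_deg m) = e then Poly_Mapping.lookup p m else 0)"
proof -
  have "finite {m. (if int (mon_deg m) = e then Poly_Mapping.lookup p m else 0) \<noteq> 0}"
    by (rule finite_subset[OF _ finite_lookup[of p]]) (auto split: if_splits)
  then show ?thesis by (simp add: hcomp_def)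
qed

lemma homog_hcomp: "homog e (hcomp e p)"
  by (auto simp: homog_def in_keys_iff lookup_hcomp split: if_splits)

lemma hcomp_id: "homog e p \<Longrightarrow> hcomp e p = p"
  by (rule poly_mapping_eqI) (auto simp: homog_def in_keys_iff lookup_hcomp)

lemma hcomp_sum: "hcomp e (sum f A) = (\<Sum>i\<in>A. hcomp e (f i))"
  by (rule poly_mapping_eqI) (simp add: lookup_hcomp lookup_sum)

text \<open>The part of \<open>p\<close> outside degree \<open>e\<close> contributes nothing in
  degree \<open>s + e\<close>. Hence a solution of a homogeneous linear system can be replaced by
  its homogeneous components.\<close>

lemma hcomp_mult:
  fixes h p :: "('v::finite, 'k::field) mpoly"
  assumes "homog s h"
  shows "hcomp (s + e) (h * p) = h * hcomp e p"
proof (rule poly_mapping_eqI)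
  fix m
  show "Poly_Mapping.lookup (hcomp (s + e) (h * p)) m = Poly_Mapping.lookup (h * hcomp e p) m"
  proof (cases "int (mon_deg m) = s + e")
    case True
    define q where "q = p - hcomp e p"
    have "m \<notin> Poly_Mapping.keys (h * q)"
    proof
      assume "m \<in> Poly_Mapping.keys (h * q)"
      then obtain k l where kl: "m = k + l" "k \<in> Poly_Mapping.keys h" "l \<in> Poly_Mapping.keys q"
        using keys_mult[of h q] by blast
      then have "int (mon_deg l) = e" using True assms by (simp add: homog_def mon_deg_add)
      then show False using kl(3) by (simp add: q_def in_keys_iff lookup_minus lookup_hcomp)
    qed
    moreover have "h * p = h * hcomp e p + h * q" by (simp add: q_def algebra_simps)
    ultimately show ?thesis using True by (simp add: lookup_hcomp lookup_add in_keys_iff)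
  next
    case False
    have "m \<notin> Poly_Mapping.keys (h * hcomp e p)"
      using False homog_mult[OF assms homog_hcomp[of e p]] by (auto simp: homog_def)
    then show ?thesis using False by (simp add: lookup_hcomp in_keys_iff)
  qed
qed

subsection \<open>The Koszul complex\<close>

text \<open>The terms at (u, v) and (v, u) cancel. Leaving out the diagonal makes this valid in
  characteristic 2 as well, where antisymmetry says nothing about \<open>c u u\<close>.\<close>

lemma sum_antisym:
  fixes c :: "'a \<Rightarrow> 'a \<Rightarrow> 'b::ab_group_add"
  assumes "finite A" "\<And>u v. u \<in> A \<Longrightarrow> v \<in> A \<Longrightarrow> u \<noteq> v \<Longrightarrow> c u v = - c v u"
  shows "(\<Sum>u\<in>A. \<Sum>v\<in>A - {u}. c u v) = 0"
  using assms
proof (induction A rule: finite_induct)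
  case (insert a B)
  have "(\<Sum>v\<in>insert a B - {u}. c u v) = c u a + (\<Sum>v\<in>B - {u}. c u v)" if "u \<in> B" for u
  proof -
    have "insert a B - {u} = insert a (B - {u})" "a \<notin> B - {u}" using insert.hyps that by auto
    then show ?thesis using insert.hyps by simp
  qed
  moreover have "insert a B - {a} = B" using insert.hyps by auto
  moreover have "(\<Sum>u\<in>B. \<Sum>v\<in>B - {u}. c u v) = 0" using insert by blast
  ultimately have "(\<Sum>u\<in>insert a B. \<Sum>v\<in>insert a B - {u}. c u v) = (\<Sum>v\<in>B. c a v) + (\<Sum>u\<in>B. c u a)"
    using insert.hyps by (simp add: sum.distrib)
  also have "\<dots> = (\<Sum>v\<in>B. c a v + c v a)" by (simp add: sum.distrib)
  also have "\<dots> = 0"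
  proof (rule sum.neutral, rule ballI)
    fix v assume "v \<in> B"
    then have "a \<noteq> v" using insert.hyps by auto
    then show "c a v + c v a = 0" using insert.prems[of a v] \<open>v \<in> B\<close> by simp
  qed
  finally show ?case .
qed simp

text \<open>The sign of moving e_v past the smaller factors of e_T. The order \<open>idx\<close>
  stays a parameter because an order adapted to the matching is chosen later.\<close>

definition ksign :: "('v \<Rightarrow> nat) \<Rightarrow> 'v \<Rightarrow> 'v set \<Rightarrow> 'k::field" where
  "ksign idx v T = (-1) ^ card {t \<in> T. idx t < idx v}"

lemma ksign_insert:
  assumes "a \<notin> (T :: 'v::finite set)"
  shows "ksign idx v (insert a T) = (if idx a < idx v then - ksign idx v T else ksign idx v T)"
proof -
  have "{t \<in> insert a T. idx t < idx v} =
      (if idx a < idx v then insert a {t \<in> T. idx t < idx v} else {t \<in> T. idx t < idx v})" by auto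
  then show ?thesis using assms by (simp add: ksign_def)
qed

lemma ksign_sq: "ksign idx v T * ksign idx v T = 1"
  by (simp add: ksign_def flip: power_mult_distrib)

text \<open>Exactly one of \<open>u\<close>, \<open>v\<close> precedes the other, so exactly one of
  the two insertions changes a sign. This gives the square zero of the Koszul differential;
  \<open>ksign_insert_insert\<close> holds for the same reason and gives the homotopy.\<close>

lemma ksign_swap:
  assumes "inj idx" "u \<noteq> v" "u \<notin> T" "v \<notin> (T :: 'v::finite set)"
  shows "(ksign idx v T :: 'k::field) * ksign idx u (insert v T) = - (ksign idx u T * ksign idx v (insert u T))"
proof -
  have "idx u \<noteq> idx v" using assms by (auto dest: injD)
  then show ?thesis using assms by (auto simp: ksign_insert)
qed

lemma ksign_insert_insert:
  assumes "inj idx" "u \<noteq> v" "u \<notin> T" "v \<notin> (T :: 'v::finite set)"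
  shows "(ksign idx v (insert u T) :: 'k::field) * ksign idx u (insert v T) = - (ksign idx u T * ksign idx v T)"
proof -
  have "idx u \<noteq> idx v" using assms by (auto dest: injD)
  then show ?thesis using assms by (auto simp: ksign_insert)
qed

text \<open>Chains of the Koszul complex are written w = (sum over S of w S e_S), without separating the
  homological degrees card S.\<close>
definition koszul :: "('v \<Rightarrow> nat) \<Rightarrow> ('v::finite set \<Rightarrow> ('v, 'k::field) mpoly) \<Rightarrow> 'v set \<Rightarrow> ('v, 'k) mpoly" where
  "koszul idx w T = (\<Sum>v\<in>- T. Poly_Mapping.single (ind {v}) (ksign idx v T) * w (insert v T))"

text \<open>In multidegree \<mu> the Koszul differential is the augmented simplicial boundary with
  coefficients in the field, on the full simplex with vertex set the support of \<mu>.\<close>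

lemma mcoeff_koszul:
  "mcoeff T (koszul idx w T) \<mu> = (\<Sum>v\<in>- T. ksign idx v T * mcoeff (insert v T) (w (insert v T)) \<mu>)"
  unfolding koszul_def mcoeff_sum
proof (rule sum.cong[OF refl])
  fix v assume "v \<in> - T"
  then have "insert v T - T = {v}" by auto
  then show "mcoeff T (Poly_Mapping.single (ind {v}) (ksign idx v T) * w (insert v T)) \<mu> =
    ksign idx v T * mcoeff (insert v T) (w (insert v T)) \<mu>"
    using mcoeff_mult[of T "insert v T"] by auto
qed

lemma koszul_diff: "koszul idx (\<lambda>S. f S - g S) T = koszul idx f T - koszul idx g T"
  by (simp add: koszul_def right_diff_distrib sum_subtractf)

lemma koszul_koszul:
  assumes "inj idx"
  shows "koszul idx (koszul idx w) T = 0"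
proof (rule mcoeff_ext[where S = T])
  fix \<mu>
  have "mcoeff T (koszul idx (koszul idx w) T) \<mu> = (\<Sum>v\<in>- T. \<Sum>u\<in>- insert v T.
      ksign idx v T * (ksign idx u (insert v T) * mcoeff (insert u (insert v T)) (w (insert u (insert v T))) \<mu>))"
    by (simp add: mcoeff_koszul sum_distrib_left)
  also have "\<dots> = (\<Sum>v\<in>- T. \<Sum>u\<in>- T - {v}.
      ksign idx v T * ksign idx u (insert v T) * mcoeff (insert u (insert v T)) (w (insert u (insert v T))) \<mu>)"
    by (intro sum.cong) (auto simp: mult.assoc)
  also have "\<dots> = 0"
  proof (rule sum_antisym)
    fix u v assume "u \<in> - T" "v \<in> - T" "u \<noteq> v"
    then show "ksign idx u T * ksign idx v (insert u T) * mcoeff (insert v (insert u T)) (w (insert v (insert u T))) \<mu> =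
       - (ksign idx v T * ksign idx u (insert v T) * mcoeff (insert u (insert v T)) (w (insert u (insert v T))) \<mu>)"
      using ksign_swap[OF assms, of u v T, where ?'k = 'b] by (simp add: insert_commute)
  qed simp
  finally show "mcoeff T (koszul idx (koszul idx w) T) \<mu> = mcoeff T 0 \<mu>" by simp
qed

text \<open>A simplex is a cone with apex \<open>a\<close>: joining a cycle with \<open>a\<close>
  gives a chain whose boundary is that cycle.\<close>

lemma cone_homotopy:
  fixes f :: "'v::finite set \<Rightarrow> 'k::field" and a :: 'v
  assumes "inj idx" and cyc: "\<And>T. (\<Sum>v\<in>- T. ksign idx v T * f (insert v T)) = 0"
  defines "g \<equiv> \<lambda>S. if a \<in> S then ksign idx a (S - {a}) * f (S - {a}) else 0"
  shows "(\<Sum>v\<in>- T. ksign idx v T * g (insert v T)) = f T"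
proof (cases "a \<in> T")
  case False
  have "(\<Sum>v\<in>- T. ksign idx v T * g (insert v T)) = (\<Sum>v\<in>{a}. ksign idx v T * g (insert v T))"
    by (rule sum.mono_neutral_right) (use False in \<open>auto simp: g_def\<close>)
  also have "\<dots> = (ksign idx a T * ksign idx a T) * f T" using False by (simp add: g_def)
  finally show ?thesis by (simp add: ksign_sq)
next
  case True
  define U where "U = T - {a}"
  have T: "T = insert a U" "a \<notin> U" using True by (auto simp: U_def)
  have "(\<Sum>v\<in>- T. ksign idx v T * g (insert v T)) =
     (\<Sum>v\<in>- T. - ksign idx a U * (ksign idx v U * f (insert v U)))"
  proof (rule sum.cong[OF refl])
    fix v assume v: "v \<in> - T"
    then have *: "insert v T - {a} = insert v U" using T by auto
    have "v \<noteq> a" "v \<notin> U" using v T by auto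
    have "ksign idx v T * g (insert v T) = ksign idx v (insert a U) * ksign idx a (insert v U) * f (insert v U)"
      using * T(1) by (simp add: g_def)
    also have "\<dots> = - (ksign idx a U * ksign idx v U) * f (insert v U)"
      using ksign_insert_insert[OF assms(1) \<open>v \<noteq> a\<close>[symmetric] T(2) \<open>v \<notin> U\<close>, where ?'k = 'k] by simp
    finally show "ksign idx v T * g (insert v T) = - ksign idx a U * (ksign idx v U * f (insert v U))"
      by simp
  qed
  \<comment> \<open>The cycle condition is applied at \<open>U\<close>, where the sum has the
    additional term \<open>v = a\<close>; that term is what survives.\<close>
  also have "\<dots> = - ksign idx a U * ((\<Sum>v\<in>- U. ksign idx v U * f (insert v U)) - ksign idx a U * f (insert a U))"
  proof -
    have "- U = insert a (- T)" "a \<notin> - T" using T by auto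
    then show ?thesis by (simp add: sum_distrib_left)
  qed
  also have "\<dots> = (ksign idx a U * ksign idx a U) * f T" by (simp add: cyc T)
  finally show ?thesis by (simp add: ksign_sq)
qed

text \<open>The Koszul complex resolves k: every nonzero multidegree has an apex in its support and
  is contracted by \<open>cone_homotopy\<close>, and in multidegree 0 only the constant term of
  \<open>w {}\<close> could be nonzero. That \<open>u {}\<close> vanishes is recorded for the
  descent in the zigzag.\<close>

lemma koszul_exact:
  fixes w :: "'v::finite set \<Rightarrow> ('v, 'k::field) mpoly"
  assumes idx: "inj idx" and cyc: "\<And>T. koszul idx w T = 0"
    and const: "Poly_Mapping.lookup (w {}) 0 = 0"
  obtains u where "u {} = 0" "\<And>T. koszul idx u T = w T"
proof -
  define a :: "('v \<Rightarrow>\<^sub>0 nat) \<Rightarrow> 'v" where "a \<mu> = (SOME v. v \<in> Poly_Mapping.keys \<mu>)" for \<mu>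
  have a: "a \<mu> \<in> Poly_Mapping.keys \<mu>" if "\<mu> \<noteq> 0" for \<mu>
    using that unfolding a_def by (metis some_in_eq keys_eq_empty)
  define f where "f \<mu> S = mcoeff S (w S) \<mu>" for \<mu> S
  define g where "g \<mu> S = (if a \<mu> \<in> S then ksign idx (a \<mu>) (S - {a \<mu>}) * f \<mu> (S - {a \<mu>}) else 0)" for \<mu> S
  have f0: "f 0 S = 0" for S using const by (auto simp: f_def mcoeff_eq ind_def)
  have sub: "S \<subseteq> Poly_Mapping.keys \<mu>" if "g \<mu> S \<noteq> 0" for \<mu> S
  proof -
    have *: "a \<mu> \<in> S" "f \<mu> (S - {a \<mu>}) \<noteq> 0" using that by (auto simp: g_def split: if_splits)
    then have "S - {a \<mu>} \<subseteq> Poly_Mapping.keys \<mu>" by (auto simp: f_def mcoeff_eq split: if_splits)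
    moreover have "\<mu> \<noteq> 0" using * f0 by metis
    ultimately show ?thesis using a by blast
  qed
  \<comment> \<open>The apex varies with \<mu>, but where \<open>g \<mu> S\<close> is nonzero it
    lies in the finite set \<open>S\<close>.\<close>
  have fin: "finite {\<mu>. g \<mu> S \<noteq> 0}" for S
  proof (rule finite_subset)
    show "{\<mu>. g \<mu> S \<noteq> 0} \<subseteq> (\<Union>v\<in>S. {\<mu>. f \<mu> (S - {v}) \<noteq> 0})"
      by (auto simp: g_def split: if_splits)
    show "finite (\<Union>v\<in>S. {\<mu>. f \<mu> (S - {v}) \<noteq> 0})"
      by (simp add: f_def finite_mcoeff)
  qed
  have "\<exists>p. \<forall>\<mu>. mcoeff S p \<mu> = g \<mu> S" for S
    using mcoeff_realize[OF fin sub, of S] by metis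
  then obtain u where u: "\<And>S \<mu>. mcoeff S (u S) \<mu> = g \<mu> S" by metis
  show thesis
  proof
    show "u {} = 0" by (rule mcoeff_ext[where S = "{}"]) (simp add: u g_def)
    fix T
    show "koszul idx u T = w T"
    proof (rule mcoeff_ext[where S = T])
      fix \<mu>
      have "(\<Sum>v\<in>- T. ksign idx v T * g \<mu> (insert v T)) = f \<mu> T"
        unfolding g_def
      proof (rule cone_homotopy[OF idx])
        fix T show "(\<Sum>v\<in>- T. ksign idx v T * f \<mu> (insert v T)) = 0"
          using mcoeff_koszul[of T idx w \<mu>] cyc by (simp add: f_def)
      qed
      then show "mcoeff T (koszul idx u T) \<mu> = mcoeff T (w T) \<mu>"
        by (simp add: mcoeff_koszul u f_def)
    qed
  qed
qed

section \<open>The double complex of the Koszul complex and a resolution\<close>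

lemma koszul_zero [simp]: "koszul idx (\<lambda>S. 0) T = 0"
  by (simp add: koszul_def)

text \<open>The two differentials of the double complex commute, without a sign, because the Koszul
  differential acts coordinatewise and R-linearly.\<close>

lemma koszul_mat_app:
  "koszul idx (\<lambda>S. mat_app n A (w S) r) T = mat_app n A (\<lambda>c. koszul idx (\<lambda>S. w S c) T) r"
  unfolding koszul_def mat_app_def sum_distrib_left
  by (rule trans[OF sum.swap]) (intro sum.cong refl mult.left_commute)

lemma mat_app_diff:
  fixes A :: "nat \<Rightarrow> nat \<Rightarrow> 'r::comm_ring"
  shows "mat_app n A (\<lambda>c. f c - g c) r = mat_app n A f r - mat_app n A g r"
  by (simp add: mat_app_def right_diff_distrib sum_subtractf)

lemma mat_app_zero [simp]: "mat_app n A (\<lambda>_. 0) = (\<lambda>_. 0)"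
  by (simp add: mat_app_def fun_eq_iff)

lemma homog_koszul:
  fixes w :: "'v::finite set \<Rightarrow> ('v, 'k::field) mpoly"
  assumes "\<And>S. homog (D - int (card S)) (w S)"
  shows "homog (D - int (card T)) (koszul idx w T)"
  unfolding koszul_def
proof (rule homog_sum)
  fix v assume "v \<in> - T"
  then have "D - int (card T) = int (mon_deg (ind {v})) + (D - int (card (insert v T)))"
    by (simp add: mon_deg_ind)
  then show "homog (D - int (card T)) (Poly_Mapping.single (ind {v}) (ksign idx v T) * w (insert v T))"
    using homog_mult[OF homog_single assms] by metis
qed

text \<open>The zigzag through the double complex (Koszul complex tensor resolution): a Koszul cycle of R/I
  in homological degree a and internal degree D is transported to the free module F_a. If F_a has no
  generator of degree D, the result lies in m F_a, and zigzagging back shows that the cycle is a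
  boundary.\<close>
lemma koszul_cycle_is_boundary:
  fixes z :: "'v::finite set \<Rightarrow> ('v, 'k::field) mpoly"
  assumes res: "graded_free_res I b d A" and idx: "inj idx"
    and cyc: "\<And>T. koszul idx z T \<in> I"
    and z0: "\<And>S. card S \<noteq> a \<Longrightarrow> z S = 0"
    and zh: "\<And>S. homog (D - int (card S)) (z S)"
    and nogen: "\<And>c. c < b a \<Longrightarrow> d a c \<noteq> D"
  obtains u where "\<And>S. z S - koszul idx u S \<in> I"
proof -
  have b0: "b 0 = 1" and d0: "d 0 0 = 0"
    and Azero: "\<And>i r c. r \<ge> b i \<or> c \<ge> b (Suc i) \<Longrightarrow> A (Suc i) r c = 0"
    and Ahom: "\<And>i r c. r < b i \<Longrightarrow> c < b (Suc i) \<Longrightarrow> homog (d (Suc i) c - d i r) (A (Suc i) r c)"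
    and I: "I = {mat_app (b 1) (A 1) v 0 | v. v \<in> free_mod (b 1)}"
    and ex: "\<And>i. {v \<in> free_mod (b (Suc i)). mat_app (b (Suc i)) (A (Suc i)) v = (\<lambda>_. 0)}
              = mat_app (b (Suc (Suc i))) (A (Suc (Suc i))) ` free_mod (b (Suc (Suc i)))"
  proof -
    note r = res[unfolded graded_free_res_def]
    show "b 0 = 1" "d 0 0 = 0" using r by blast+
    show "A (Suc i) r c = 0" if "r \<ge> b i \<or> c \<ge> b (Suc i)" for i r c
      using r[THEN conjunct2, THEN conjunct2, THEN conjunct1, rule_format, of "Suc i" r c] that by simp
    show "homog (d (Suc i) c - d i r) (A (Suc i) r c)" if "r < b i" "c < b (Suc i)" for i r c
      using r[THEN conjunct2, THEN conjunct2, THEN conjunct2, THEN conjunct1, rule_format, of "Suc i" r c] that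
      by simp
    show "I = {mat_app (b 1) (A 1) v 0 | v. v \<in> free_mod (b 1)}" using r by blast
    show "{v \<in> free_mod (b (Suc i)). mat_app (b (Suc i)) (A (Suc i)) v = (\<lambda>_. 0)}
              = mat_app (b (Suc (Suc i))) (A (Suc (Suc i))) ` free_mod (b (Suc (Suc i)))" for i
      using r[THEN conjunct2, THEN conjunct2, THEN conjunct2, THEN conjunct2, THEN conjunct2, THEN conjunct1,
          rule_format, of "Suc i"] by simp
  qed
  define bd where "bd i w S = mat_app (b i) (A i) (w S)" for i and w :: "'v set \<Rightarrow> nat \<Rightarrow> ('v, 'k) mpoly" and S
  define kz where "kz w S c = koszul idx (\<lambda>S. w S c) S" for w :: "'v set \<Rightarrow> nat \<Rightarrow> ('v, 'k) mpoly" and S c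
  have bd_kz: "bd i (kz w) = kz (bd i w)" for i w
    by (intro ext) (simp add: bd_def kz_def koszul_mat_app kz_def[abs_def])
  have kz_kz: "kz (kz w) = (\<lambda>_ _. 0)" for w
    by (simp add: fun_eq_iff kz_def koszul_koszul[OF idx])
  \<comment> \<open>The position in the double complex: resolution degree \<open>i\<close>, Koszul
    degree \<open>a - i\<close>, total internal degree \<open>D\<close>, with e_S counted in degree
    \<open>card S\<close> and the generator \<open>c\<close> in degree \<open>d i c\<close>.\<close>
  define good where "good i w \<longleftrightarrow> (\<forall>S. w S \<in> free_mod (b i)) \<and> (\<forall>S c. card S + i \<noteq> a \<longrightarrow> w S c = 0) \<and>
     (\<forall>S c. homog (D - int (card S) - d i c) (w S c))"
    for i and w :: "'v set \<Rightarrow> nat \<Rightarrow> ('v, 'k) mpoly"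
  define w0 where "w0 S c = (if c = 0 then z S else 0)" for S and c :: nat
  define P where "P i w \<longleftrightarrow> good i w \<and> (if i = 0 then w = w0 else bd i (kz w) = (\<lambda>_ _. 0))" for i w
  have "P 0 w0"
    using zh z0 by (auto simp: P_def good_def w0_def free_mod_def b0 d0)
  moreover have "\<exists>w'. P (Suc i) w' \<and> bd (Suc i) w' = kz w" if Pw: "P i w" for i w
  proof -
    have good: "good i w" using Pw by (simp add: P_def)
    have kfree: "kz w S \<in> free_mod (b i)" for S
      using good by (auto simp: good_def free_mod_def kz_def)
    \<comment> \<open>The Koszul boundary lifts through the resolution: at the start because it lies
      in \<open>I\<close>, the image of the first map, and afterwards by exactness.\<close>
    have "\<exists>v. v \<in> free_mod (b (Suc i)) \<and> mat_app (b (Suc i)) (A (Suc i)) v = kz w S" for S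
    proof (cases i)
      case 0
      then have "kz w S 0 \<in> I" using Pw cyc by (simp add: P_def kz_def w0_def)
      then obtain v where v: "v \<in> free_mod (b 1)" "kz w S 0 = mat_app (b 1) (A 1) v 0"
        unfolding I by blast
      have "mat_app (b 1) (A 1) v r = kz w S r" for r
      proof (cases "r = 0")
        case False
        then have "kz w S r = 0" using kfree[of S] 0 b0 by (auto simp: free_mod_def)
        moreover have "A 1 r c = 0" for c using Azero[of 0 r] False b0 by simp
        ultimately show ?thesis by (simp add: mat_app_def)
      qed (use v in simp)
      then show ?thesis using v 0 by auto
    next
      case (Suc j)
      then have "mat_app (b (Suc j)) (A (Suc j)) (kz w S) = (\<lambda>_. 0)"
        using Pw by (simp add: P_def bd_def fun_eq_iff)
      then have "kz w S \<in> mat_app (b (Suc (Suc j))) (A (Suc (Suc j))) ` free_mod (b (Suc (Suc j)))"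
        using ex[of j] kfree[of S] Suc by blast
      then show ?thesis using Suc by auto
    qed
    then obtain v where v: "\<And>S. v S \<in> free_mod (b (Suc i))"
        "\<And>S. mat_app (b (Suc i)) (A (Suc i)) (v S) = kz w S" by metis
    \<comment> \<open>The lift \<open>v\<close> is arbitrary; since the matrix is homogeneous,
      cutting \<open>v\<close> down to the required degrees does not change its image.\<close>
    define w' where "w' S c = (if card S + Suc i = a then hcomp (D - int (card S) - d (Suc i) c) (v S c) else 0)" for S c
    have "good (Suc i) w'"
      using v(1) by (auto simp: good_def w'_def free_mod_def homog_hcomp hcomp_id)
    moreover have eq: "bd (Suc i) w' = kz w"
    proof (intro ext)
      fix S :: "'v set" and r :: nat
      consider "r \<ge> b i" | "r < b i" "card S + Suc i \<noteq> a" | "r < b i" "card S + Suc i = a" by linarith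
      then show "bd (Suc i) w' S r = kz w S r"
      proof cases
        case 1
        then have "A (Suc i) r c = 0" for c using Azero by blast
        then have "bd (Suc i) w' S r = 0" by (simp add: bd_def mat_app_def)
        moreover have "kz w S r = 0" using 1 kfree[of S] by (auto simp: free_mod_def)
        ultimately show ?thesis by simp
      next
        case 2
        have "w (insert x S) r = 0" if "x \<notin> S" for x
        proof -
          have "card (insert x S) + i \<noteq> a" using 2 that by simp
          then show ?thesis using good by (simp add: good_def)
        qed
        then have "kz w S r = 0" by (simp add: kz_def koszul_def)
        then show ?thesis using 2 by (simp add: bd_def mat_app_def w'_def)
      next
        case 3
        let ?e = "D - int (card S) - d i r"
        have "homog (D - d i r - int (card S)) (kz w S r)"
          unfolding kz_def
        proof (rule homog_koszul)
          fix S have "homog (D - int (card S) - d i r) (w S r)" using good by (simp add: good_def)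
          then show "homog (D - d i r - int (card S)) (w S r)" by (simp add: algebra_simps)
        qed
        then have "kz w S r = hcomp ?e (kz w S r)" by (simp add: hcomp_id algebra_simps)
        also have "\<dots> = (\<Sum>c<b (Suc i). hcomp ?e (A (Suc i) r c * v S c))"
          by (simp add: v(2)[symmetric] mat_app_def hcomp_sum)
        also have "\<dots> = (\<Sum>c<b (Suc i). A (Suc i) r c * w' S c)"
        proof (rule sum.cong[OF refl])
          fix c assume "c \<in> {..<b (Suc i)}"
          then have "homog (d (Suc i) c - d i r) (A (Suc i) r c)" using Ahom 3 by simp
          from hcomp_mult[OF this, of "D - int (card S) - d (Suc i) c" "v S c"]
          show "hcomp ?e (A (Suc i) r c * v S c) = A (Suc i) r c * w' S c"
            using 3 by (simp add: w'_def)
        qed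
        finally show ?thesis by (simp add: bd_def mat_app_def)
      qed
    qed
    moreover have "bd (Suc i) (kz w') = (\<lambda>_ _. 0)" by (simp add: bd_kz eq kz_kz)
    ultimately show ?thesis by (auto simp: P_def)
  qed
  ultimately obtain w where w: "\<And>i. P i (w i)" "\<And>i. bd (Suc i) (w (Suc i)) = kz (w i)"
    using dependent_nat_choice[of P "\<lambda>i w w'. bd (Suc i) w' = kz w"] by metis
  have goodw: "good i (w i)" for i using w(1) by (simp add: P_def)
  have wfree: "w i S c = 0" if "c \<ge> b i" for i S c
    using goodw[of i] that by (auto simp: good_def free_mod_def)
  have lift: "\<exists>u. (\<forall>S. u S \<in> free_mod (b i)) \<and> u {} = (\<lambda>_. 0) \<and> kz u = y"
    if "\<And>S. y S \<in> free_mod (b i)" "kz y = (\<lambda>_ _. 0)" "\<And>c. Poly_Mapping.lookup (y {} c) 0 = 0" for i y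
  proof -
    have "\<exists>u. u {} = 0 \<and> (\<forall>T. koszul idx u T = y T c)" for c
    proof (rule koszul_exact[OF idx, of "\<lambda>S. y S c"])
      show "koszul idx (\<lambda>S. y S c) T = 0" for T using that(2) by (simp add: kz_def fun_eq_iff)
    qed (use that(3) in auto)
    then obtain u where u: "\<And>c. u c {} = 0" "\<And>c T. koszul idx (u c) T = y T c" by metis
    have "kz (\<lambda>S c. if c < b i then u c S else 0) S c = y S c" for S c
    proof (cases "c < b i")
      case False
      then have "y S c = 0" using that(1)[of S] by (simp add: free_mod_def)
      then show ?thesis using False by (simp add: kz_def)
    qed (simp add: kz_def u(2))
    then show ?thesis
      by (intro exI[of _ "\<lambda>S c. if c < b i then u c S else 0"]) (auto simp: free_mod_def u(1))
  qed
  \<comment> \<open>The way back, descending from \<open>i = a\<close> to 0: \<open>w i\<close> is a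
    Koszul boundary plus an image under the resolution. At 0 that image lies in
    \<open>I\<close>.\<close>
  have "\<exists>u u'. (\<forall>S. u S \<in> free_mod (b i)) \<and> (\<forall>S. u' S \<in> free_mod (b (Suc i))) \<and> u {} = (\<lambda>_. 0) \<and>
     kz u = (\<lambda>S c. w i S c - bd (Suc i) u' S c)" if "i \<le> a" for i
    using that
  proof (induction i rule: inc_induct)
    case base
    have "\<exists>u. (\<forall>S. u S \<in> free_mod (b a)) \<and> u {} = (\<lambda>_. 0) \<and> kz u = w a"
    proof (rule lift)
      show "w a S \<in> free_mod (b a)" for S using goodw by (simp add: good_def)
      have "w a (insert v S) c = 0" if "v \<notin> S" for v S c
        using goodw[of a] that by (simp add: good_def)
      then show "kz (w a) = (\<lambda>_ _. 0)" by (simp add: kz_def koszul_def fun_eq_iff)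
      \<comment> \<open>The missing generator enters here: the coordinate has degree
        \<open>D - d a c\<close>, which is nonzero, so it has no constant term.\<close>
      show "Poly_Mapping.lookup (w a {} c) 0 = 0" for c
      proof (cases "c < b a")
        case True
        have "homog (D - d a c) (w a {} c)" using goodw[of a] unfolding good_def
          by (metis card.empty diff_zero of_nat_0)
        then show ?thesis using nogen[OF True] by (force simp: homog_def in_keys_iff)
      qed (simp add: wfree)
    qed
    then obtain u where u: "\<And>S. u S \<in> free_mod (b a)" "u {} = (\<lambda>_. 0)" "kz u = w a" by auto
    have "bd (Suc a) (\<lambda>_ _. 0) S c = 0" for S c by (simp add: bd_def)
    then show ?case
      by (intro exI[of _ u] exI[of _ "\<lambda>_ _. 0"] conjI) (use u in \<open>simp_all add: free_mod_def\<close>)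
  next
    case (step i)
    from step.IH obtain u u' where u: "\<forall>S. u S \<in> free_mod (b (Suc i))" "\<forall>S. u' S \<in> free_mod (b (Suc (Suc i)))"
      "u {} = (\<lambda>_. 0)" "kz u = (\<lambda>S c. w (Suc i) S c - bd (Suc (Suc i)) u' S c)" by blast
    define y where "y S c = w i S c - bd (Suc i) u S c" for S c
    have "\<exists>v. (\<forall>S. v S \<in> free_mod (b i)) \<and> v {} = (\<lambda>_. 0) \<and> kz v = y"
    proof (rule lift)
      have "bd (Suc i) u S c = 0" if "c \<ge> b i" for S c
        using Azero that by (simp add: bd_def mat_app_def)
      then show "y S \<in> free_mod (b i)" for S by (simp add: free_mod_def y_def wfree)
      \<comment> \<open>Below \<open>a\<close> the chain \<open>w i\<close> has positive Koszul
        degree, and \<open>u {}\<close> vanishes, so \<open>y {}\<close> is zero and has no constant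
        term.\<close>
      have "w i {} c = 0" for c using goodw[of i] step.hyps by (simp add: good_def)
      then show "Poly_Mapping.lookup (y {} c) 0 = 0" for c by (simp add: y_def bd_def u(3))
      have "bd (Suc i) (bd (Suc (Suc i)) u') S = (\<lambda>_. 0)" for S
        using ex[of i] u(2) unfolding bd_def by blast
      then have 0: "bd (Suc i) (bd (Suc (Suc i)) u') S c = 0" for S c by (simp add: fun_eq_iff)
      \<comment> \<open>The Koszul boundary of \<open>y\<close> is the resolution map applied to
        \<open>w (Suc i) - kz u\<close>, which is itself an image under the next map; two
        consecutive maps compose to zero.\<close>
      have "kz y S c = kz (w i) S c - kz (bd (Suc i) u) S c" for S c
        by (simp add: kz_def y_def koszul_diff)
      also have "\<dots> S c = bd (Suc i) (w (Suc i)) S c - bd (Suc i) (kz u) S c" for S c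
        by (simp add: w(2) bd_kz)
      also have "\<dots> S c = 0" for S c
        unfolding u(4) using 0[of S c] by (simp add: bd_def mat_app_diff)
      finally show "kz y = (\<lambda>_ _. 0)" by (simp add: fun_eq_iff)
    qed
    then show ?case using u(1) unfolding y_def by blast
  qed
  from this[of 0] obtain u u' where u: "\<And>S. u' S \<in> free_mod (b 1)"
    "kz u = (\<lambda>S c. w 0 S c - bd 1 u' S c)" by auto
  have "w 0 = w0" using w(1)[of 0] by (simp add: P_def)
  show thesis
  proof
    fix S
    have "koszul idx (\<lambda>S. u S 0) S = z S - bd 1 u' S 0"
      using fun_cong[OF fun_cong[OF u(2)], of S 0] \<open>w 0 = w0\<close> by (simp add: kz_def w0_def)
    then have "z S - koszul idx (\<lambda>S. u S 0) S = mat_app (b 1) (A 1) (u' S) 0" by (simp add: bd_def)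
    then show "z S - koszul idx (\<lambda>S. u S 0) S \<in> I" unfolding I using u(1) by blast
  qed
qed

subsection \<open>A Koszul cycle of the closed neighborhood ideal\<close>

lemma poly_mapping_expand:
  fixes f :: "('a \<Rightarrow>\<^sub>0 'b::comm_monoid_add)"
  shows "(\<Sum>\<mu>\<in>Poly_Mapping.keys f. Poly_Mapping.single \<mu> (Poly_Mapping.lookup f \<mu>)) = f"
  by (rule poly_mapping_eqI) (auto simp: lookup_sum lookup_single when_def in_keys_iff)

text \<open>Membership in a monomial ideal is decided monomial by monomial, and squarefree
  generators only see supports. Conversely, each monomial of \<open>f\<close> is charged to one
  generator dividing it, and \<open>c i\<close> collects the quotients.\<close>

lemma NI_iff:
  fixes f :: "('v::finite, 'k::field) mpoly"
  shows "f \<in> NI E \<longleftrightarrow> (\<forall>\<mu>. Poly_Mapping.lookup f \<mu> \<noteq> 0 \<longrightarrow> (\<exists>i. closed_nbhd E i \<subseteq> Poly_Mapping.keys \<mu>))"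
proof
  assume "f \<in> NI E"
  then obtain c where f: "f = (\<Sum>i\<in>UNIV. c i * var_prod (closed_nbhd E i))" unfolding NI_def by blast
  show "\<forall>\<mu>. Poly_Mapping.lookup f \<mu> \<noteq> 0 \<longrightarrow> (\<exists>i. closed_nbhd E i \<subseteq> Poly_Mapping.keys \<mu>)"
  proof (intro allI impI)
    fix \<mu> assume "Poly_Mapping.lookup f \<mu> \<noteq> 0"
    then obtain i where "Poly_Mapping.lookup (c i * var_prod (closed_nbhd E i)) \<mu> \<noteq> 0"
      unfolding f lookup_sum by (meson sum.not_neutral_contains_not_neutral)
    then show "\<exists>i. closed_nbhd E i \<subseteq> Poly_Mapping.keys \<mu>"
      by (auto simp: var_prod_ind mult.commute[of "c i"] lookup_single_ind_mult split: if_splits)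
  qed
next
  assume "\<forall>\<mu>. Poly_Mapping.lookup f \<mu> \<noteq> 0 \<longrightarrow> (\<exists>i. closed_nbhd E i \<subseteq> Poly_Mapping.keys \<mu>)"
  then obtain g where g: "\<And>\<mu>. Poly_Mapping.lookup f \<mu> \<noteq> 0 \<Longrightarrow> closed_nbhd E (g \<mu>) \<subseteq> Poly_Mapping.keys \<mu>"
    by metis
  define c where "c i = (\<Sum>\<mu>\<in>{\<mu>\<in>Poly_Mapping.keys f. g \<mu> = i}.
    Poly_Mapping.single (\<mu> - ind (closed_nbhd E i)) (Poly_Mapping.lookup f \<mu>))" for i
  have "c i * var_prod (closed_nbhd E i) =
     (\<Sum>\<mu>\<in>{\<mu>\<in>Poly_Mapping.keys f. g \<mu> = i}. Poly_Mapping.single \<mu> (Poly_Mapping.lookup f \<mu>))" for i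
    unfolding c_def sum_distrib_right
  proof (rule sum.cong[OF refl])
    fix \<mu> assume "\<mu> \<in> {\<mu>\<in>Poly_Mapping.keys f. g \<mu> = i}"
    then have "closed_nbhd E i \<subseteq> Poly_Mapping.keys \<mu>" using g by (auto simp: in_keys_iff)
    then have "\<mu> - ind (closed_nbhd E i) + ind (closed_nbhd E i) = \<mu>"
      by (intro poly_mapping_eqI) (auto simp: lookup_add lookup_minus lookup_ind in_keys_iff subset_iff)
    then show "Poly_Mapping.single (\<mu> - ind (closed_nbhd E i)) (Poly_Mapping.lookup f \<mu>) * var_prod (closed_nbhd E i) =
      Poly_Mapping.single \<mu> (Poly_Mapping.lookup f \<mu>)"
      by (simp add: var_prod_ind mult_single)
  qed
  then have "(\<Sum>i\<in>UNIV. c i * var_prod (closed_nbhd E i)) = f"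
    using sum.group[of "Poly_Mapping.keys f" UNIV g "\<lambda>\<mu>. Poly_Mapping.single \<mu> (Poly_Mapping.lookup f \<mu>)"]
    by (simp add: poly_mapping_expand)
  then show "f \<in> NI E" unfolding NI_def by (metis (mono_tags, lifting) mem_Collect_eq)
qed

text \<open>Doubling a numbering leaves the odd places free; the partner of \<open>x\<close> takes
  the place right after \<open>x\<close>.\<close>

lemma ex_adapted_order:
  fixes y :: "'v::finite \<Rightarrow> 'v"
  assumes "inj_on y X" "y ` X \<inter> X = {}"
  obtains idx :: "'v \<Rightarrow> nat" where "inj idx" "\<And>x. x \<in> X \<Longrightarrow> idx (y x) = Suc (idx x)"
proof -
  obtain f :: "'v \<Rightarrow> nat" where f: "inj f" using finite_imp_inj_to_nat_seg[of "UNIV :: 'v set"] by auto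
  define idx where "idx v = (if v \<in> y ` X then 2 * f (inv_into X y v) + 1 else 2 * f v)" for v
  show thesis
  proof
    show "inj idx"
    proof (rule injI)
      fix u v assume eq: "idx u = idx v"
      have "2 * m + 1 \<noteq> 2 * n" for m n :: nat by presburger
      then have "u \<in> y ` X \<longleftrightarrow> v \<in> y ` X" using eq unfolding idx_def by metis
      then show "u = v" using eq by (auto simp: idx_def assms(1) dest!: injD[OF f])
    qed
    show "idx (y x) = Suc (idx x)" if "x \<in> X" for x
      using that assms by (auto simp: idx_def)
  qed
qed

text \<open>No vertex lies between \<open>x\<close> and \<open>y\<close>, so both see the same
  smaller elements of \<open>T\<close>; only \<open>x\<close> itself, which precedes
  \<open>y\<close>, makes the difference.\<close>

lemma ksign_adapted:
  assumes "inj idx" "idx y = Suc (idx x)" "x \<notin> T" "y \<notin> (T :: 'v::finite set)"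
  shows "(ksign idx y (insert x T) :: 'k::field) = - ksign idx x (insert y T)"
proof -
  have "idx t < idx y \<longleftrightarrow> idx t < idx x" if "t \<in> T" for t
    using assms that by (auto simp: less_Suc_eq dest: injD)
  then have "{t \<in> T. idx t < idx y} = {t \<in> T. idx t < idx x}" by auto
  then have "ksign idx y T = ksign idx x T" by (simp add: ksign_def)
  then show ?thesis using assms by (simp add: ksign_insert)
qed

text \<open>The Koszul cycle is x^(y ` X) e_X. It is detected by the functional adding up the coefficients
  of x^(\<sigma> - T) e_T over the transversals T of the matching, \<sigma> being the set of matched vertices:
  in the order idx the two ends of a matching edge are consecutive, hence the signs of the
  two faces of a set containing both ends cancel.\<close>
lemma graded_free_res_NI_generator:
  fixes E :: "'v::finite set set"
  assumes K: "koenig_matching E X y"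
    and res: "graded_free_res (NI E :: ('v, 'k::field) mpoly set) b d A"
  shows "\<exists>c<b (card X). d (card X) c = 2 * int (card X)"
proof (rule ccontr)
  assume nogen: "\<not> (\<exists>c<b (card X). d (card X) c = 2 * int (card X))"
  have inj: "inj_on y X" and disj: "y ` X \<inter> X = {}" and edge: "\<And>x. x \<in> X \<Longrightarrow> {x, y x} \<in> E"
    and nbhd: "\<And>x j. x \<in> X \<Longrightarrow> {x, j} \<in> E \<Longrightarrow> j \<in> y ` X"
    using K unfolding koenig_matching_def by blast+
  obtain idx :: "'v \<Rightarrow> nat" where idx: "inj idx" "\<And>x. x \<in> X \<Longrightarrow> idx (y x) = Suc (idx x)"
    using ex_adapted_order[OF inj disj] by metis
  define Y where "Y = y ` X"
  define \<sigma> where "\<sigma> = X \<union> Y"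
  define z :: "'v set \<Rightarrow> ('v, 'k) mpoly" where "z S = (if S = X then Poly_Mapping.single (ind Y) 1 else 0)" for S
  have cyc: "koszul idx z T \<in> NI E" for T
    unfolding NI_iff
  proof (intro allI impI)
    fix \<mu> assume "Poly_Mapping.lookup (koszul idx z T) \<mu> \<noteq> 0"
    then obtain v where v: "v \<notin> T"
      "Poly_Mapping.lookup (Poly_Mapping.single (ind {v}) (ksign idx v T) * z (insert v T)) \<mu> \<noteq> 0"
      unfolding koszul_def lookup_sum by (auto elim: sum.not_neutral_contains_not_neutral)
    then have X: "insert v T = X" by (auto simp: z_def split: if_splits)
    have "v \<in> Poly_Mapping.keys \<mu>" "Poly_Mapping.lookup (Poly_Mapping.single (ind Y) (1::'k)) (\<mu> - ind {v}) \<noteq> 0"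
      using v(2) X by (auto simp: z_def lookup_single_ind_mult split: if_splits)
    then have "\<mu> - ind {v} = ind Y" by (auto simp: lookup_single when_def split: if_splits)
    have "u \<in> Poly_Mapping.keys \<mu>" if "u \<in> Y" for u
    proof -
      have "Poly_Mapping.lookup (\<mu> - ind {v}) u = 1" using \<open>\<mu> - ind {v} = ind Y\<close> that by (simp add: lookup_ind)
      then show ?thesis by (simp add: lookup_minus in_keys_iff)
    qed
    \<comment> \<open>The neighbors of a vertex of \<open>X\<close> are all partners, so the
      monomial x_v x^Y is a multiple of a generator of the ideal.\<close>
    moreover have "closed_nbhd E v \<subseteq> insert v Y"
      using nbhd X unfolding closed_nbhd_def Y_def by blast
    ultimately show "\<exists>i. closed_nbhd E i \<subseteq> Poly_Mapping.keys \<mu>"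
      using \<open>v \<in> Poly_Mapping.keys \<mu>\<close> by blast
  qed
  have "card Y = card X" unfolding Y_def by (simp add: card_image inj)
  then have zh: "homog (2 * int (card X) - int (card S)) (z S)" for S
    using homog_single[of "ind Y" "1::'k"] by (simp add: z_def mon_deg_ind)
  obtain u where u: "\<And>S. z S - koszul idx u S \<in> NI E"
  proof (rule koszul_cycle_is_boundary[OF res idx(1) cyc _ zh])
    show "card S \<noteq> card X \<Longrightarrow> z S = 0" for S by (auto simp: z_def)
    show "c < b (card X) \<Longrightarrow> d (card X) c \<noteq> 2 * int (card X)" for c using nogen by blast
  qed (blast intro: that)
  define Tr where "Tr = {T. T \<subseteq> \<sigma> \<and> (\<forall>x\<in>X. (x \<in> T) \<noteq> (y x \<in> T))}"
  define U where "U S = mcoeff S (u S) (ind \<sigma>)" for S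
  \<comment> \<open>For a transversal \<open>T\<close>, the end of the matching edge of
    \<open>x\<close> that \<open>T\<close> misses.\<close>
  define other where "other T x = (if x \<in> T then y x else x)" for T x
  have coeff: "mcoeff T (z T) (ind \<sigma>) = (\<Sum>x\<in>X. ksign idx (other T x) T * U (insert (other T x) T))"
    if T: "T \<in> Tr" for T
  proof -
    have T': "T \<subseteq> \<sigma>" "\<And>x. x \<in> X \<Longrightarrow> (x \<in> T) \<noteq> (y x \<in> T)" using T by (auto simp: Tr_def)
    have keys: "Poly_Mapping.keys (ind \<sigma> - ind T) = \<sigma> - T"
      by (auto simp: in_keys_iff lookup_minus lookup_ind split: if_splits)
    \<comment> \<open>The complement of a transversal in \<sigma> is again a transversal, whereas
      the closed neighborhood of a matched vertex contains both ends of its edge. Hence the equation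
      modulo the ideal is an exact equation for this coefficient.\<close>
    have "\<not> closed_nbhd E i \<subseteq> \<sigma> - T" for i
    proof
      assume i: "closed_nbhd E i \<subseteq> \<sigma> - T"
      then have "i \<in> \<sigma>" "i \<notin> T" unfolding closed_nbhd_def by auto
      then obtain x where x: "x \<in> X" "i = x \<or> i = y x" unfolding \<sigma>_def Y_def by blast
      have "{x, y x} \<in> E" "{y x, x} \<in> E" using edge[OF x(1)] by (simp_all add: insert_commute)
      then have "x \<in> closed_nbhd E i" "y x \<in> closed_nbhd E i" using x(2) unfolding closed_nbhd_def by auto
      then show False using i T'(2)[OF x(1)] by blast
    qed
    then have "Poly_Mapping.lookup (z T - koszul idx u T) (ind \<sigma> - ind T) = 0"
      using u[of T] unfolding NI_iff by (metis keys)
    then have "mcoeff T (z T - koszul idx u T) (ind \<sigma>) = 0" by (simp add: mcoeff_eq)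
    then have "mcoeff T (z T) (ind \<sigma>) = (\<Sum>v\<in>- T. ksign idx v T * U (insert v T))"
      by (simp add: mcoeff_diff mcoeff_koszul U_def)
    also have "\<dots> = (\<Sum>v\<in>\<sigma> - T. ksign idx v T * U (insert v T))"
      by (rule sum.mono_neutral_right) (auto simp: U_def mcoeff_eq)
    also have "\<dots> = (\<Sum>x\<in>X. ksign idx (other T x) T * U (insert (other T x) T))"
    proof (rule sum.reindex_bij_betw[symmetric])
      show "bij_betw (other T) X (\<sigma> - T)"
        unfolding bij_betw_def
      proof
        show "inj_on (other T) X"
          using inj disj unfolding inj_on_def other_def by (auto split: if_splits)
        show "other T ` X = \<sigma> - T"
          using T'(2) unfolding other_def \<sigma>_def Y_def by (auto simp: image_iff)
      qed
    qed
    finally show ?thesis .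
  qed
  have cancel: "(\<Sum>T\<in>Tr. ksign idx (other T x) T * U (insert (other T x) T)) = 0" if x: "x \<in> X" for x
  proof -
    let ?h = "\<lambda>T. ksign idx (other T x) T * U (insert (other T x) T)"
    have xy: "x \<noteq> y x" using x disj by (metis IntI empty_iff imageI)
    have yX: "y x \<notin> X" using x disj by blast
    have mem: "(w = x) = (y w = y x)" if "w \<in> X" for w using inj x that by (auto dest: inj_onD)
    \<comment> \<open>Transversals are paired by exchanging \<open>x\<close> and \<open>y x\<close>;
      adding the missing end to either one gives the same set, with opposite signs.\<close>
    have "bij_betw (\<lambda>T. insert (y x) (T - {x})) {T \<in> Tr. x \<in> T} {T \<in> Tr. x \<notin> T}"
    proof (rule bij_betw_byWitness[where f' = "\<lambda>T. insert x (T - {y x})"])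
      show "\<forall>T\<in>{T \<in> Tr. x \<in> T}. insert x (insert (y x) (T - {x}) - {y x}) = T"
        using x xy unfolding Tr_def by blast
      show "\<forall>T\<in>{T \<in> Tr. x \<notin> T}. insert (y x) (insert x (T - {y x}) - {x}) = T"
        using x xy unfolding Tr_def by blast
      show "(\<lambda>T. insert (y x) (T - {x})) ` {T \<in> Tr. x \<in> T} \<subseteq> {T \<in> Tr. x \<notin> T}"
      proof clarify
        fix T assume T: "T \<in> Tr" "x \<in> T"
        have "insert (y x) (T - {x}) \<subseteq> \<sigma>" using T x unfolding Tr_def \<sigma>_def Y_def by blast
        moreover have "(w \<in> insert (y x) (T - {x})) \<noteq> (y w \<in> insert (y x) (T - {x}))" if "w \<in> X" for w
        proof (cases "w = x")
          case False
          then have "w \<noteq> y x" "y w \<noteq> x" "y w \<noteq> y x" using mem that yX disj x by auto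
          then show ?thesis using False T that unfolding Tr_def by auto
        qed (use xy in auto)
        ultimately show "insert (y x) (T - {x}) \<in> Tr \<and> x \<notin> insert (y x) (T - {x})"
          using xy unfolding Tr_def by auto
      qed
      show "(\<lambda>T. insert x (T - {y x})) ` {T \<in> Tr. x \<notin> T} \<subseteq> {T \<in> Tr. x \<in> T}"
      proof clarify
        fix T assume T: "T \<in> Tr" "x \<notin> T"
        have "insert x (T - {y x}) \<subseteq> \<sigma>" using T x unfolding Tr_def \<sigma>_def Y_def by blast
        moreover have "(w \<in> insert x (T - {y x})) \<noteq> (y w \<in> insert x (T - {y x}))" if "w \<in> X" for w
        proof (cases "w = x")
          case False
          then have "w \<noteq> y x" "y w \<noteq> x" "y w \<noteq> y x" using mem that yX disj x by auto
          then show ?thesis using False T that unfolding Tr_def by auto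
        qed (use xy in auto)
        ultimately show "insert x (T - {y x}) \<in> Tr \<and> x \<in> insert x (T - {y x})"
          using xy unfolding Tr_def by auto
      qed
    qed
    then have "(\<Sum>T\<in>{T \<in> Tr. x \<notin> T}. ?h T) = (\<Sum>T\<in>{T \<in> Tr. x \<in> T}. ?h (insert (y x) (T - {x})))"
      by (rule sum.reindex_bij_betw[symmetric])
    also have "\<dots> = (\<Sum>T\<in>{T \<in> Tr. x \<in> T}. - ?h T)"
    proof (rule sum.cong[OF refl])
      fix T assume T: "T \<in> {T \<in> Tr. x \<in> T}"
      define T0 where "T0 = T - {x}"
      have T0: "T = insert x T0" "x \<notin> T0" "y x \<notin> T0" using T x unfolding T0_def Tr_def by auto
      have "?h (insert (y x) T0) = ksign idx x (insert (y x) T0) * U (insert x (insert (y x) T0))"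
        using T0 xy by (simp add: other_def)
      moreover have "?h T = ksign idx (y x) (insert x T0) * U (insert x (insert (y x) T0))"
        using T0 by (simp add: other_def insert_commute)
      ultimately show "?h (insert (y x) (T - {x})) = - ?h T"
        using ksign_adapted[OF idx(1) idx(2)[OF x] T0(2,3), where ?'k = 'k] by (simp add: T0_def)
    qed
    finally have "(\<Sum>T\<in>{T \<in> Tr. x \<notin> T}. ?h T) + (\<Sum>T\<in>{T \<in> Tr. x \<in> T}. ?h T) = 0"
      by (simp add: sum_negf)
    moreover have "(\<Sum>T\<in>Tr. ?h T) = (\<Sum>T\<in>{T \<in> Tr. x \<notin> T}. ?h T) + (\<Sum>T\<in>{T \<in> Tr. x \<in> T}. ?h T)"
      by (subst sum.union_disjoint[symmetric]) (auto intro: sum.cong)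
    ultimately show ?thesis by simp
  qed
  \<comment> \<open>The functional takes the value 1 on the cycle, whose only term sits at the
    transversal \<open>X\<close>, and 0 on the boundary: a contradiction.\<close>
  have "X \<in> Tr" using disj unfolding Tr_def \<sigma>_def by blast
  have "ind \<sigma> = ind Y + ind X" using disj ind_Un[of Y X] by (simp add: \<sigma>_def Y_def Un_commute)
  then have "(1::'k) = mcoeff X (z X) (ind \<sigma>)"
    using lookup_eq_mcoeff[of "z X" "ind Y" X] by (simp add: z_def)
  also have "\<dots> = (\<Sum>T\<in>Tr. mcoeff T (z T) (ind \<sigma>))"
  proof -
    have "(\<Sum>T\<in>Tr. mcoeff T (z T) (ind \<sigma>)) = (\<Sum>T\<in>{X}. mcoeff T (z T) (ind \<sigma>))"
      using \<open>X \<in> Tr\<close> by (intro sum.mono_neutral_right) (auto simp: z_def)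
    then show ?thesis by simp
  qed
  also have "\<dots> = (\<Sum>T\<in>Tr. \<Sum>x\<in>X. ksign idx (other T x) T * U (insert (other T x) T))"
    by (rule sum.cong[OF refl coeff])
  also have "\<dots> = (\<Sum>x\<in>X. \<Sum>T\<in>Tr. ksign idx (other T x) T * U (insert (other T x) T))"
    by (rule sum.swap)
  also have "\<dots> = 0" by (simp add: cancel)
  finally show False by simp
qed

subsection \<open>Existence of the minimal resolution\<close>

interpretation coords: vector_space "\<lambda>(a::'k::field) (v::nat \<Rightarrow> 'k) r. a * v r"
  by unfold_locales (simp_all add: fun_eq_iff algebra_simps)

lemma sum_fun_apply: "(\<Sum>i\<in>A. f i) x = (\<Sum>i\<in>A. f i x)" for f :: "'a \<Rightarrow> 'b \<Rightarrow> 'c::comm_monoid_add"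
  by (induction A rule: infinite_finite_induct) simp_all

lemma coords_span_explicit:
  fixes g :: "'a \<Rightarrow> nat \<Rightarrow> 'k::field"
  assumes "finite J" "v \<in> coords.span (g ` J)"
  shows "\<exists>a. v = (\<lambda>r. \<Sum>j\<in>J. a j * g j r)"
  using assms
proof (induction J arbitrary: v rule: finite_induct)
  case empty
  then show ?case by (auto simp: fun_eq_iff)
next
  case (insert i J)
  then obtain k where "v - (\<lambda>r. k * g i r) \<in> coords.span (g ` J)"
    by (auto simp: coords.span_breakdown_eq)
  then obtain a where a: "v - (\<lambda>r. k * g i r) = (\<lambda>r. \<Sum>j\<in>J. a j * g j r)" using insert.IH by blast
  have "v r = (\<Sum>j\<in>insert i J. (a(i := k)) j * g j r)" for r
  proof -
    have "(\<Sum>j\<in>J. (a(i := k)) j * g j r) = (\<Sum>j\<in>J. a j * g j r)"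
      using insert.hyps by (intro sum.cong) auto
    then show ?thesis using fun_cong[OF a, of r] insert.hyps by (simp add: algebra_simps)
  qed
  then show ?case by blast
qed

lemma coords_sum_in_span:
  fixes g :: "'a \<Rightarrow> nat \<Rightarrow> 'k::field"
  shows "(\<lambda>r. \<Sum>j\<in>J. a j * g j r) \<in> coords.span (g ` J)"
proof -
  have "(\<Sum>j\<in>J. (\<lambda>r. a j * g j r)) \<in> coords.span (g ` J)"
    by (intro coords.span_sum coords.span_scale coords.span_base) auto
  also have "(\<Sum>j\<in>J. (\<lambda>r. a j * g j r)) = (\<lambda>r. \<Sum>j\<in>J. a j * g j r)"
    by (simp add: fun_eq_iff sum_fun_apply)
  finally show ?thesis .
qed

lemma coords_subspace_lincomb:
  fixes V :: "(nat \<Rightarrow> 'k::field) set"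
  assumes "coords.subspace V" "\<And>j. j \<in> J \<Longrightarrow> a j \<noteq> 0 \<Longrightarrow> g j \<in> V"
  shows "(\<lambda>r. \<Sum>j\<in>J. a j * g j r) \<in> V"
proof -
  have "(\<lambda>r. a j * g j r) \<in> V" if "j \<in> J" for j
  proof (cases "a j = 0")
    case True
    then show ?thesis using coords.subspace_0[OF assms(1)] by (simp add: zero_fun_def)
  next
    case False
    then show ?thesis using coords.subspace_scale[OF assms(1) assms(2)] that by blast
  qed
  then have "(\<Sum>j\<in>J. (\<lambda>r. a j * g j r)) \<in> V" by (intro coords.subspace_sum assms(1))
  also have "(\<Sum>j\<in>J. (\<lambda>r. a j * g j r)) = (\<lambda>r. \<Sum>j\<in>J. a j * g j r)"
    by (simp add: fun_eq_iff sum_fun_apply)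
  finally show ?thesis .
qed

lemma coords_finite_basis:
  fixes V :: "(nat \<Rightarrow> 'k::field) set"
  assumes "\<And>v r. v \<in> V \<Longrightarrow> r \<ge> N \<Longrightarrow> v r = 0"
  obtains B where "finite B" "B \<subseteq> V" "V \<subseteq> coords.span B"
proof -
  obtain B where B: "B \<subseteq> V" "coords.independent B" "V \<subseteq> coords.span B"
    using coords.basis_exists[of V] by metis
  define e :: "nat \<Rightarrow> nat \<Rightarrow> 'k" where "e j r = (if r = j then 1 else 0)" for j r
  have "B \<subseteq> coords.span (e ` {..<N})"
  proof
    fix v assume "v \<in> B"
    then have "v r = (\<Sum>j<N. v j * e j r)" for r
      using assms[of v r] B(1) by (cases "r < N") (auto simp: e_def if_distrib cong: if_cong)
    then have "v = (\<lambda>r. \<Sum>j<N. v j * e j r)" by blast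
    then show "v \<in> coords.span (e ` {..<N})" using coords_sum_in_span[where J = "{..<N}"] by metis
  qed
  then have "finite B" using coords.independent_span_bound[OF _ B(2)] by blast
  then show thesis using that B by blast
qed

text \<open>Squarefree multigraded free modules are given by a rank b and multidegrees m c (c < b); their
  piece of multidegree S is the space of vectors in the coordinates c with m c contained in S.\<close>
definition supp_in :: "nat \<Rightarrow> (nat \<Rightarrow> 'v set) \<Rightarrow> 'v set \<Rightarrow> (nat \<Rightarrow> 'k::field) \<Rightarrow> bool" where
  "supp_in b m S a \<longleftrightarrow> (\<forall>c. a c \<noteq> 0 \<longrightarrow> c < b \<and> m c \<subseteq> S)"

definition syz :: "nat \<Rightarrow> (nat \<Rightarrow> 'v set) \<Rightarrow> (nat \<Rightarrow> nat \<Rightarrow> 'k::field) \<Rightarrow> 'v set \<Rightarrow> (nat \<Rightarrow> 'k) set" where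
  "syz b m g S = {a. supp_in b m S a \<and> (\<forall>r. (\<Sum>c<b. a c * g c r) = 0)}"

text \<open>The last clause is minimality in the sense of Nakayama: a relation of multidegree
  \<open>S\<close> has no unit coefficient, that is, none at a generator of multidegree
  \<open>S\<close> itself.\<close>

definition min_gens ::
  "('v set \<Rightarrow> (nat \<Rightarrow> 'k::field) set) \<Rightarrow> nat \<Rightarrow> (nat \<Rightarrow> 'v set) \<Rightarrow> (nat \<Rightarrow> nat \<Rightarrow> 'k) \<Rightarrow> bool" where
  "min_gens V b m g \<longleftrightarrow> (\<forall>c<b. g c \<in> V (m c)) \<and>
     (\<forall>S. \<forall>v\<in>V S. \<exists>a. supp_in b m S a \<and> v = (\<lambda>r. \<Sum>c<b. a c * g c r)) \<and>
     (\<forall>S. \<forall>a\<in>syz b m g S. \<forall>c<b. m c = S \<longrightarrow> a c = 0)"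

text \<open>Bases of the finitely many pieces together generate, so a generating family of least
  size exists. A relation with a unit coefficient would express one of its generators by the others,
  contradicting least size.\<close>

lemma min_gens_exists:
  fixes V :: "'v::finite set \<Rightarrow> (nat \<Rightarrow> 'k::field) set"
  assumes "\<And>S v r. v \<in> V S \<Longrightarrow> r \<ge> N \<Longrightarrow> v r = 0"
  shows "\<exists>b m g. min_gens V b m g"
proof -
  define gen where "gen P \<longleftrightarrow> finite P \<and> (\<forall>p\<in>P. snd p \<in> V (fst p)) \<and>
    (\<forall>S. V S \<subseteq> coords.span (snd ` {p \<in> P. fst p \<subseteq> S}))" for P
  have "\<exists>B. finite B \<and> B \<subseteq> V S \<and> V S \<subseteq> coords.span B" for S
    using coords_finite_basis[of "V S" N] assms by metis
  then obtain B where B: "\<And>S. finite (B S)" "\<And>S. B S \<subseteq> V S" "\<And>S. V S \<subseteq> coords.span (B S)" by metis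
  have "gen (Sigma UNIV B)"
    unfolding gen_def
  proof (intro conjI allI ballI)
    show "finite (Sigma UNIV B)" using B(1) by (intro finite_SigmaI) simp_all
    show "snd p \<in> V (fst p)" if "p \<in> Sigma UNIV B" for p using that subsetD[OF B(2)] by auto
    fix S
    have "B S \<subseteq> snd ` {p \<in> Sigma UNIV B. fst p \<subseteq> S}" by force
    then show "V S \<subseteq> coords.span (snd ` {p \<in> Sigma UNIV B. fst p \<subseteq> S})"
      using B(3)[of S] coords.span_mono by blast
  qed
  then obtain P where P: "gen P" and least: "\<And>P'. gen P' \<Longrightarrow> card P \<le> card P'"
    using ex_has_least_nat[of gen _ card] by metis
  have finP: "finite P" using P by (simp add: gen_def)
  then obtain h where h: "bij_betw h {..<card P} P"
    using ex_bij_betw_nat_finite[of P] by (metis atLeast0LessThan)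
  define m where "m c = fst (h c)" for c
  define g where "g c = snd (h c)" for c
  have hP: "h c \<in> P" if "c < card P" for c using h that by (auto simp: bij_betw_def)
  have img: "snd ` {p \<in> P. fst p \<subseteq> S} = g ` {c. c < card P \<and> m c \<subseteq> S}" for S
  proof -
    have "p \<in> P \<longleftrightarrow> (\<exists>c<card P. p = h c)" for p using h by (auto simp: bij_betw_def)
    then have "{p \<in> P. fst p \<subseteq> S} = h ` {c. c < card P \<and> m c \<subseteq> S}" by (auto simp: m_def image_iff)
    then show ?thesis by (simp add: g_def image_image)
  qed
  have "min_gens V (card P) m g"
    unfolding min_gens_def
  proof (intro conjI allI ballI impI)
    show "g c \<in> V (m c)" if "c < card P" for c
      using P hP[OF that] by (simp add: gen_def m_def g_def)
  next
    fix S v assume "v \<in> V S"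
    then have "v \<in> coords.span (g ` {c. c < card P \<and> m c \<subseteq> S})"
      using P unfolding gen_def img by blast
    then obtain a where a: "v = (\<lambda>r. \<Sum>c\<in>{c. c < card P \<and> m c \<subseteq> S}. a c * g c r)"
      using coords_span_explicit[of "{c. c < card P \<and> m c \<subseteq> S}" v g] by auto
    define a' where "a' c = (if c < card P \<and> m c \<subseteq> S then a c else 0)" for c
    have "supp_in (card P) m S a'" by (auto simp: supp_in_def a'_def)
    moreover have "(\<Sum>c\<in>{c. c < card P \<and> m c \<subseteq> S}. a c * g c r) = (\<Sum>c<card P. a' c * g c r)" for r
      by (rule sum.mono_neutral_cong_left) (auto simp: a'_def)
    ultimately show "\<exists>a. supp_in (card P) m S a \<and> v = (\<lambda>r. \<Sum>c<card P. a c * g c r)"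
      unfolding a by auto
  next
    fix S a d
    assume a: "a \<in> syz (card P) m g S" and d: "d < card P" "m d = S"
    show "a d = 0"
    proof (rule ccontr)
      assume ad: "a d \<noteq> 0"
      define J where "J = {c. c < card P \<and> m c \<subseteq> S} - {d}"
      have J: "finite J" "d \<notin> J" by (simp_all add: J_def)
      have supp: "\<And>c. a c \<noteq> 0 \<Longrightarrow> c < card P \<and> m c \<subseteq> S" using a by (auto simp: syz_def supp_in_def)
      have "g d r = (\<Sum>c\<in>J. (- a c / a d) * g c r)" for r
      proof -
        have "0 = (\<Sum>c<card P. a c * g c r)" using a by (simp add: syz_def)
        also have "\<dots> = (\<Sum>c\<in>insert d J. a c * g c r)"
          by (rule sum.mono_neutral_right) (use supp d J_def in auto)
        also have "\<dots> = a d * g d r + (\<Sum>c\<in>J. a c * g c r)" using J by simp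
        finally have "g d r = - (\<Sum>c\<in>J. a c * g c r) / a d" using ad by (simp add: field_simps eq_neg_iff_add_eq_0)
        then show ?thesis by (simp add: sum_divide_distrib sum_negf)
      qed
      then have "g d = (\<lambda>r. \<Sum>c\<in>J. (- a c / a d) * g c r)" by blast
      then have gd: "g d \<in> coords.span (g ` J)" using coords_sum_in_span[where J = J] by metis
      define P' where "P' = P - {h d}"
      have "gen P'"
        unfolding gen_def
      proof (intro conjI allI ballI)
        show "finite P'" using finP by (simp add: P'_def)
        show "snd p \<in> V (fst p)" if "p \<in> P'" for p using that P by (simp add: gen_def P'_def)
        fix S'
        have "snd p \<in> coords.span (snd ` {p \<in> P'. fst p \<subseteq> S'})" if p: "p \<in> P" "fst p \<subseteq> S'" for p
        proof (cases "p = h d")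
          case False
          then show ?thesis using p by (intro coords.span_base) (auto simp: P'_def)
        next
          case True
          \<comment> \<open>A piece that can use the dropped generator contains its multidegree,
            hence also the multidegrees of the generators that replace it.\<close>
          then have SS: "S \<subseteq> S'" using p d by (simp add: m_def)
          have "g ` J \<subseteq> snd ` {p \<in> P'. fst p \<subseteq> S'}"
          proof
            fix v assume "v \<in> g ` J"
            then obtain c where c: "c \<in> J" "v = g c" by blast
            then have "h c \<noteq> h d" using h d by (auto simp: J_def bij_betw_def dest: inj_onD)
            then have "h c \<in> {p \<in> P'. fst p \<subseteq> S'}" using c SS hP by (auto simp: J_def P'_def m_def)
            then show "v \<in> snd ` {p \<in> P'. fst p \<subseteq> S'}" using c by (auto simp: g_def)
          qed
          then have "g d \<in> coords.span (snd ` {p \<in> P'. fst p \<subseteq> S'})" using gd coords.span_mono by blast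
          then show ?thesis using True by (simp add: g_def)
        qed
        then have "coords.span (snd ` {p \<in> P. fst p \<subseteq> S'}) \<subseteq> coords.span (snd ` {p \<in> P'. fst p \<subseteq> S'})"
          by (intro coords.span_minimal) auto
        then show "V S' \<subseteq> coords.span (snd ` {p \<in> P'. fst p \<subseteq> S'})" using P by (auto simp: gen_def)
      qed
      moreover have "card P' < card P" using card_Diff1_less[OF finP hP[OF d(1)]] by (simp only: P'_def)
      ultimately show False using least by fastforce
    qed
  qed
  then show ?thesis by blast
qed

lemma subspace_syz: "coords.subspace (syz b m g S)"
proof (rule coords.subspaceI)
  show "0 \<in> syz b m g S" by (simp add: syz_def supp_in_def)
  show "x + y \<in> syz b m g S" if xy: "x \<in> syz b m g S" "y \<in> syz b m g S" for x y
  proof -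
    have "c < b \<and> m c \<subseteq> S" if "x c + y c \<noteq> 0" for c
    proof -
      have "x c \<noteq> 0 \<or> y c \<noteq> 0" using that by auto
      then show ?thesis using xy unfolding syz_def supp_in_def by blast
    qed
    then show ?thesis using xy by (simp add: syz_def supp_in_def distrib_right sum.distrib)
  qed
  show "(\<lambda>r. k * x r) \<in> syz b m g S" if "x \<in> syz b m g S" for k x
    using that by (simp add: syz_def supp_in_def mult.assoc sum_distrib_left[symmetric])
qed

lemma syz_mono: "S \<subseteq> S' \<Longrightarrow> syz b m g S \<subseteq> syz b m g S'"
  unfolding syz_def supp_in_def by blast

text \<open>The piece of the neighborhood ideal in any multidegree with support S, as a space of vectors with
  the single coordinate 0.\<close>
definition NI_piece :: "'v set set \<Rightarrow> 'v set \<Rightarrow> (nat \<Rightarrow> 'k::field) set" where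
  "NI_piece E S = {v. \<forall>r. v r \<noteq> 0 \<longrightarrow> r = 0 \<and> (\<exists>i. closed_nbhd E i \<subseteq> S)}"

lemma subspace_NI_piece: "coords.subspace (NI_piece E S)"
proof (rule coords.subspaceI)
  show "x + y \<in> NI_piece E S" if xy: "x \<in> NI_piece E S" "y \<in> NI_piece E S" for x y
    unfolding NI_piece_def
  proof (intro CollectI allI impI)
    fix r assume "(x + y) r \<noteq> 0"
    then have "x r \<noteq> 0 \<or> y r \<noteq> 0" by auto
    then show "r = 0 \<and> (\<exists>i. closed_nbhd E i \<subseteq> S)" using xy unfolding NI_piece_def by blast
  qed
qed (auto simp: NI_piece_def)

lemma NI_piece_mono: "S \<subseteq> S' \<Longrightarrow> NI_piece E S \<subseteq> NI_piece E S'"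
  unfolding NI_piece_def by blast

text \<open>All multidegrees are subsets of the vertex set and increase strictly along the resolution, which
  bounds its length.\<close>
lemma minimal_graded_free_res_NI_exists:
  fixes E :: "'v::finite set set"
  shows "\<exists>b d A. minimal_graded_free_res (NI E :: ('v, 'k::field) mpoly set) b d A"
proof -
  define Z where "Z x = syz (fst x) (fst (snd x)) (snd (snd x))"
    for x :: "nat \<times> (nat \<Rightarrow> 'v set) \<times> (nat \<Rightarrow> nat \<Rightarrow> 'k)"
  define mg where "mg V x = min_gens V (fst x) (fst (snd x)) (snd (snd x))"
    for V and x :: "nat \<times> (nat \<Rightarrow> 'v set) \<times> (nat \<Rightarrow> nat \<Rightarrow> 'k)"
  have "\<exists>x. mg (NI_piece E) x"
    using min_gens_exists[of "NI_piece E" 1] by (auto simp: mg_def NI_piece_def)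
  moreover have "\<exists>x'. mg (Z x) x'" for x
    using min_gens_exists[of "Z x" "fst x"] by (fastforce simp: mg_def Z_def syz_def supp_in_def)
  ultimately obtain st where st0: "mg (NI_piece E) (st 0)" and stS: "\<And>i. mg (Z (st i)) (st (Suc i))"
    using dependent_nat_choice[of "\<lambda>i x. i = 0 \<longrightarrow> mg (NI_piece E) x" "\<lambda>i x x'. mg (Z x) x'"]
    by (metis nat.distinct(1))
  define b where "b i = (case i of 0 \<Rightarrow> 1 | Suc j \<Rightarrow> fst (st j))" for i
  define m where "m i = (case i of 0 \<Rightarrow> (\<lambda>_. {}) | Suc j \<Rightarrow> fst (snd (st j)))" for i
  define g where "g i = (case i of 0 \<Rightarrow> (\<lambda>_ _. 0) | Suc j \<Rightarrow> snd (snd (st j)))" for i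
  \<comment> \<open>What the generators of stage \<open>Suc i\<close> have to cover: the ideal at
    the start, the kernel of the previous map afterwards. Stage 0 is R, with one generator of empty
    multidegree.\<close>
  define V where "V i = (if i = 0 then NI_piece E else syz (b i) (m i) (g i))" for i
  have mg: "min_gens (V i) (b (Suc i)) (m (Suc i)) (g (Suc i))" for i
  proof (cases i)
    case 0
    then show ?thesis using st0 by (simp add: V_def b_def m_def g_def mg_def)
  next
    case (Suc j)
    then show ?thesis using stS[of j] by (simp add: V_def b_def m_def g_def mg_def Z_def)
  qed
  have sub: "coords.subspace (V i S)" for i S
    by (simp add: V_def subspace_NI_piece subspace_syz)
  have mono: "V i S \<subseteq> V i S'" if "S \<subseteq> S'" for i S S'
    by (simp add: V_def NI_piece_mono[OF that] syz_mono[OF that])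
  have gV: "g (Suc i) c \<in> V i (m (Suc i) c)" if "c < b (Suc i)" for i c
    using mg that unfolding min_gens_def by blast
  have gen: "\<exists>a. supp_in (b (Suc i)) (m (Suc i)) S a \<and> v = (\<lambda>r. \<Sum>c<b (Suc i). a c * g (Suc i) c r)"
    if "v \<in> V i S" for i S v
    using mg that unfolding min_gens_def by blast
  have min: "a c = 0" if "a \<in> syz (b (Suc i)) (m (Suc i)) (g (Suc i)) (m (Suc i) c)" "c < b (Suc i)" for i a c
    using mg that unfolding min_gens_def by blast
  \<comment> \<open>Strictness comes from the closed neighborhoods being nonempty when
    \<open>i = 0\<close>, and from minimality afterwards. It yields both the minimality of the
    matrices and the bound on the length.\<close>
  have strict: "r < b i \<and> m i r \<subset> S" if v: "v \<in> V i S" "v r \<noteq> 0" for i S v r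
  proof (cases i)
    case 0
    then have "r = 0" "\<exists>j. closed_nbhd E j \<subseteq> S" using v by (auto simp: V_def NI_piece_def)
    then show ?thesis using 0 by (auto simp: b_def m_def closed_nbhd_def)
  next
    case (Suc j)
    then have "v \<in> syz (b i) (m i) (g i) S" using v by (simp add: V_def)
    then have "r < b i" "m i r \<subseteq> S" using v(2) by (auto simp: syz_def supp_in_def)
    moreover have "m i r \<noteq> S" using min[of v j r] \<open>v \<in> syz (b i) (m i) (g i) S\<close> v(2) \<open>r < b i\<close> Suc by auto
    ultimately show ?thesis by blast
  qed
  have gstrict: "r < b i \<and> m i r \<subset> m (Suc i) c" if "c < b (Suc i)" "g (Suc i) c r \<noteq> 0" for i c r
    using strict[OF gV[OF that(1)] that(2)] .
  have cardm: "i \<le> card (m i c)" if "c < b i" for i c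
    using that
  proof (induction i arbitrary: c)
    case (Suc i)
    \<comment> \<open>A zero generator would make its own unit vector a relation, against
      minimality. A nonzero coordinate points to a generator one stage below of strictly smaller
      multidegree.\<close>
    have "\<exists>r. g (Suc i) c r \<noteq> 0"
    proof (rule ccontr)
      assume "\<nexists>r. g (Suc i) c r \<noteq> 0"
      then have "(\<Sum>d<b (Suc i). (if d = c then 1 else 0) * g (Suc i) d r) = 0" for r
        by (intro sum.neutral) auto
      then have "(\<lambda>d. if d = c then 1 else 0) \<in> syz (b (Suc i)) (m (Suc i)) (g (Suc i)) (m (Suc i) c)"
        using Suc.prems by (auto simp: syz_def supp_in_def)
      from min[OF this Suc.prems] show False by simp
    qed
    then obtain r where "r < b i" "m i r \<subset> m (Suc i) c" using gstrict[OF Suc.prems] by blast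
    then show ?case using Suc.IH[of r] psubset_card_mono[of "m (Suc i) c" "m i r"] by simp
  qed simp
  \<comment> \<open>The scalar matrix \<open>g\<close> is made multigraded. Its nonzero entries
    satisfy \<open>m (i - 1) r \<subset> m i c\<close>, so the set difference is the quotient of the
    two multidegrees.\<close>
  define A :: "nat \<Rightarrow> nat \<Rightarrow> nat \<Rightarrow> ('v, 'k) mpoly" where
    "A i r c = (if r < b (i - 1) \<and> c < b i then Poly_Mapping.single (ind (m i c - m (i - 1) r)) (g i c r) else 0)" for i r c
  define coef where "coef i v \<mu> r = mcoeff (m i r) (v r) \<mu>" for i and v :: "nat \<Rightarrow> ('v, 'k) mpoly" and \<mu> r
  have coef_A: "coef i (mat_app (b (Suc i)) (A (Suc i)) w) \<mu> =
      (\<lambda>r. \<Sum>c<b (Suc i). coef (Suc i) w \<mu> c * g (Suc i) c r)" for i w \<mu>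
  proof
    fix r
    have "mcoeff (m i r) (A (Suc i) r c * w c) \<mu> = coef (Suc i) w \<mu> c * g (Suc i) c r" if c: "c < b (Suc i)" for c
    proof (cases "g (Suc i) c r = 0")
      case True
      then show ?thesis by (simp add: A_def)
    next
      case False
      then have r: "r < b i" "m i r \<subseteq> m (Suc i) c" using gstrict[OF c] by auto
      show ?thesis using r c by (simp add: A_def mcoeff_mult coef_def)
    qed
    then show "coef i (mat_app (b (Suc i)) (A (Suc i)) w) \<mu> r =
        (\<Sum>c<b (Suc i). coef (Suc i) w \<mu> c * g (Suc i) c r)"
      by (simp add: coef_def mat_app_def mcoeff_sum)
  qed
  have coef_ext: "v = v'" if "\<And>\<mu>. coef i v \<mu> = coef i v' \<mu>" for i v v'
  proof
    fix r
    show "v r = v' r"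
    proof (rule mcoeff_ext[where S = "m i r"])
      show "mcoeff (m i r) (v r) \<mu> = mcoeff (m i r) (v' r) \<mu>" for \<mu>
        using fun_cong[OF that[of \<mu>], of r] by (simp add: coef_def)
    qed
  qed
  have coef_supp: "supp_in (b i) (m i) (Poly_Mapping.keys \<mu>) (coef i v \<mu>)" if "v \<in> free_mod (b i)" for i v \<mu>
    unfolding supp_in_def
  proof (intro allI impI)
    fix c assume c: "coef i v \<mu> c \<noteq> 0"
    then have "v c \<noteq> 0" by (auto simp: coef_def)
    then have "c < b i" using that by (auto simp: free_mod_def not_less[symmetric])
    then show "c < b i \<and> m i c \<subseteq> Poly_Mapping.keys \<mu>"
      using c by (auto simp: coef_def mcoeff_eq split: if_splits)
  qed
  have image: "mat_app (b (Suc i)) (A (Suc i)) ` free_mod (b (Suc i)) =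
      {v \<in> free_mod (b i). \<forall>\<mu>. coef i v \<mu> \<in> V i (Poly_Mapping.keys \<mu>)}" for i
  proof (intro equalityI subsetI)
    fix v assume "v \<in> mat_app (b (Suc i)) (A (Suc i)) ` free_mod (b (Suc i))"
    then obtain w where w: "w \<in> free_mod (b (Suc i))" "v = mat_app (b (Suc i)) (A (Suc i)) w" by blast
    have "v \<in> free_mod (b i)" unfolding w by (simp add: free_mod_def mat_app_def A_def)
    moreover have "coef i v \<mu> \<in> V i (Poly_Mapping.keys \<mu>)" for \<mu>
      unfolding w(2) coef_A
    proof (rule coords_subspace_lincomb[OF sub])
      fix c assume "c \<in> {..<b (Suc i)}" "coef (Suc i) w \<mu> c \<noteq> 0"
      then have "m (Suc i) c \<subseteq> Poly_Mapping.keys \<mu>" "c < b (Suc i)"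
        using coef_supp[OF w(1), of \<mu>] by (auto simp: supp_in_def)
      then show "g (Suc i) c \<in> V i (Poly_Mapping.keys \<mu>)" using mono gV by blast
    qed
    ultimately show "v \<in> {v \<in> free_mod (b i). \<forall>\<mu>. coef i v \<mu> \<in> V i (Poly_Mapping.keys \<mu>)}" by simp
  next
    fix v assume "v \<in> {v \<in> free_mod (b i). \<forall>\<mu>. coef i v \<mu> \<in> V i (Poly_Mapping.keys \<mu>)}"
    then have v: "v \<in> free_mod (b i)" "\<And>\<mu>. coef i v \<mu> \<in> V i (Poly_Mapping.keys \<mu>)" by auto
    \<comment> \<open>Choosing the zero solution wherever \<open>v\<close> has no coefficient keeps
      the family finitely supported, as required for reassembling polynomials.\<close>
    have "\<exists>a. supp_in (b (Suc i)) (m (Suc i)) (Poly_Mapping.keys \<mu>) a \<and>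
        coef i v \<mu> = (\<lambda>r. \<Sum>c<b (Suc i). a c * g (Suc i) c r) \<and> (coef i v \<mu> = (\<lambda>_. 0) \<longrightarrow> a = (\<lambda>_. 0))" for \<mu>
    proof (cases "coef i v \<mu> = (\<lambda>_. 0)")
      case True
      then show ?thesis by (intro exI[of _ "\<lambda>_. 0"]) (simp add: supp_in_def)
    next
      case False
      then show ?thesis using gen[OF v(2)] by blast
    qed
    then obtain a where a: "\<And>\<mu>. supp_in (b (Suc i)) (m (Suc i)) (Poly_Mapping.keys \<mu>) (a \<mu>)"
      "\<And>\<mu>. coef i v \<mu> = (\<lambda>r. \<Sum>c<b (Suc i). a \<mu> c * g (Suc i) c r)"
      "\<And>\<mu>. coef i v \<mu> = (\<lambda>_. 0) \<Longrightarrow> a \<mu> = (\<lambda>_. 0)" by metis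
    have "finite {\<mu>. a \<mu> c \<noteq> 0}" for c
    proof (rule finite_subset)
      show "{\<mu>. a \<mu> c \<noteq> 0} \<subseteq> (\<Union>r<b i. {\<mu>. mcoeff (m i r) (v r) \<mu> \<noteq> 0})"
      proof
        fix \<mu> assume "\<mu> \<in> {\<mu>. a \<mu> c \<noteq> 0}"
        then have "coef i v \<mu> \<noteq> (\<lambda>_. 0)" using a(3)[of \<mu>] by auto
        then obtain r where "coef i v \<mu> r \<noteq> 0" by (auto simp: fun_eq_iff)
        moreover from this have "r < b i" using coef_supp[OF v(1), of \<mu>] by (auto simp: supp_in_def)
        ultimately show "\<mu> \<in> (\<Union>r<b i. {\<mu>. mcoeff (m i r) (v r) \<mu> \<noteq> 0})" by (auto simp: coef_def)
      qed
    qed (simp add: finite_mcoeff)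
    moreover have "m (Suc i) c \<subseteq> Poly_Mapping.keys \<mu>" if "a \<mu> c \<noteq> 0" for \<mu> c
      using a(1)[of \<mu>] that by (auto simp: supp_in_def)
    ultimately have "\<exists>p. \<forall>\<mu>. mcoeff (m (Suc i) c) p \<mu> = a \<mu> c" for c
      using mcoeff_realize[of "\<lambda>\<mu>. a \<mu> c" "m (Suc i) c"] by metis
    then obtain w where w: "\<And>c \<mu>. mcoeff (m (Suc i) c) (w c) \<mu> = a \<mu> c" by metis
    then have coef_w: "coef (Suc i) w \<mu> = a \<mu>" for \<mu> by (simp add: coef_def fun_eq_iff)
    have "w c = 0" if "c \<ge> b (Suc i)" for c
    proof (rule mcoeff_ext[where S = "m (Suc i) c"])
      fix \<mu>
      have "a \<mu> c = 0" using a(1)[of \<mu>] that by (auto simp: supp_in_def not_less[symmetric])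
      then show "mcoeff (m (Suc i) c) (w c) \<mu> = mcoeff (m (Suc i) c) 0 \<mu>" by (simp add: w)
    qed
    then have "w \<in> free_mod (b (Suc i))" by (simp add: free_mod_def)
    moreover have "v = mat_app (b (Suc i)) (A (Suc i)) w"
      by (rule coef_ext[of i]) (simp only: coef_A coef_w a(2))
    ultimately show "v \<in> mat_app (b (Suc i)) (A (Suc i)) ` free_mod (b (Suc i))" by blast
  qed
  \<comment> \<open>This is the set that \<open>image\<close> gives at the next index, so exactness
    is the comparison of the two.\<close>
  have kernel: "{v \<in> free_mod (b (Suc i)). mat_app (b (Suc i)) (A (Suc i)) v = (\<lambda>_. 0)} =
      {v \<in> free_mod (b (Suc i)). \<forall>\<mu>. coef (Suc i) v \<mu> \<in> V (Suc i) (Poly_Mapping.keys \<mu>)}" for i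
  proof (intro Collect_cong conj_cong refl)
    fix v :: "nat \<Rightarrow> ('v, 'k) mpoly" assume v: "v \<in> free_mod (b (Suc i))"
    have 0: "coef i (\<lambda>_. 0) \<mu> = (\<lambda>_. 0)" for \<mu> by (simp add: coef_def fun_eq_iff)
    have "mat_app (b (Suc i)) (A (Suc i)) v = (\<lambda>_. 0) \<longleftrightarrow>
        (\<forall>\<mu>. coef i (mat_app (b (Suc i)) (A (Suc i)) v) \<mu> = (\<lambda>_. 0))"
      using coef_ext[of i "mat_app (b (Suc i)) (A (Suc i)) v" "\<lambda>_. 0"] by (auto simp: 0)
    also have "\<dots> \<longleftrightarrow> (\<forall>\<mu>. coef (Suc i) v \<mu> \<in> V (Suc i) (Poly_Mapping.keys \<mu>))"
      using coef_supp[OF v] by (simp add: coef_A V_def syz_def fun_eq_iff)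
    finally show "mat_app (b (Suc i)) (A (Suc i)) v = (\<lambda>_. 0) \<longleftrightarrow>
        (\<forall>\<mu>. coef (Suc i) v \<mu> \<in> V (Suc i) (Poly_Mapping.keys \<mu>))" .
  qed
  have ideal: "{mat_app (b 1) (A 1) v 0 | v. v \<in> free_mod (b 1)} = NI E"
  proof -
    have mem: "v \<in> mat_app (b 1) (A 1) ` free_mod (b 1) \<longleftrightarrow> v \<in> free_mod 1 \<and> v 0 \<in> NI E" for v
    proof -
      have "coef 0 v \<mu> \<in> V 0 (Poly_Mapping.keys \<mu>) \<longleftrightarrow>
          (Poly_Mapping.lookup (v 0) \<mu> \<noteq> 0 \<longrightarrow> (\<exists>i. closed_nbhd E i \<subseteq> Poly_Mapping.keys \<mu>))"
        if "v \<in> free_mod 1" for \<mu>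
      proof -
        have "coef 0 v \<mu> r = (if r = 0 then Poly_Mapping.lookup (v 0) \<mu> else 0)" for r
          using that by (auto simp: coef_def m_def mcoeff_eq ind_def free_mod_def)
        then show ?thesis by (auto simp: V_def NI_piece_def)
      qed
      then show ?thesis using image[of 0] unfolding NI_iff by (auto simp: b_def)
    qed
    show ?thesis
    proof (intro equalityI subsetI)
      fix f assume "f \<in> {mat_app (b 1) (A 1) v 0 | v. v \<in> free_mod (b 1)}"
      then obtain v where "f = mat_app (b 1) (A 1) v 0" "v \<in> free_mod (b 1)" by blast
      then show "f \<in> NI E" using mem[of "mat_app (b 1) (A 1) v"] by blast
    next
      fix f :: "('v, 'k) mpoly" assume "f \<in> NI E"
      then have "(\<lambda>r. if r = 0 then f else 0) \<in> mat_app (b 1) (A 1) ` free_mod (b 1)"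
        using mem by (simp add: free_mod_def)
      then obtain v where v: "v \<in> free_mod (b 1)" "(\<lambda>r. if r = 0 then f else 0) = mat_app (b 1) (A 1) v" by blast
      then have "f = mat_app (b 1) (A 1) v 0" using fun_cong[OF v(2), of 0] by simp
      with v(1) show "f \<in> {mat_app (b 1) (A 1) v 0 | v. v \<in> free_mod (b 1)}" by blast
    qed
  qed
  have Asub: "A (Suc i) r c = 0 \<or> r < b i \<and> c < b (Suc i) \<and> m i r \<subset> m (Suc i) c" for i r c
    using gstrict[of c i r] by (cases "g (Suc i) c r = 0") (auto simp: A_def)
  have "graded_free_res (NI E) b (\<lambda>i c. int (card (m i c))) A"
    unfolding graded_free_res_def
  proof (intro conjI allI impI)
    show "b 0 = 1" by (simp add: b_def)
    show "int (card (m 0 0)) = 0" by (simp add: m_def)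
    show "A i r c = 0" if "1 \<le> i" "b (i - 1) \<le> r \<or> b i \<le> c" for i r c
      using that by (auto simp: A_def)
    show "homog (int (card (m i c)) - int (card (m (i - 1) r))) (A i r c)"
      if "1 \<le> i" "r < b (i - 1)" "c < b i" for i r c
    proof -
      have "i \<noteq> 0" using that(1) by simp
      then obtain j where i: "i = Suc j" by (cases i) auto
      show ?thesis
      proof (cases "A i r c = 0")
        case False
        then have "m j r \<subseteq> m i c" using Asub[of j r c] i by auto
        then have "int (card (m i c)) - int (card (m (i - 1) r)) = int (mon_deg (ind (m i c - m (i - 1) r)))"
          using i by (simp add: mon_deg_ind card_Diff_subset card_mono of_nat_diff)
        then show ?thesis using homog_single[of "ind (m i c - m (i - 1) r)" "g i c r"] that by (simp add: A_def)
      qed simp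
    qed
    show "{mat_app (b 1) (A 1) v 0 | v. v \<in> free_mod (b 1)} = NI E" by (rule ideal)
    show "{v \<in> free_mod (b i). mat_app (b i) (A i) v = (\<lambda>_. 0)} =
        mat_app (b (Suc i)) (A (Suc i)) ` free_mod (b (Suc i))" if "1 \<le> i" for i
      using that kernel[of "i - 1"] image[of i] by simp
    show "\<exists>p. \<forall>i>p. b i = 0"
    proof (intro exI allI impI)
      fix i assume i: "card (UNIV :: 'v set) < i"
      show "b i = 0"
      proof (rule ccontr)
        assume "b i \<noteq> 0"
        then have "i \<le> card (m i 0)" using cardm by blast
        also have "\<dots> \<le> card (UNIV :: 'v set)" by (rule card_mono) simp_all
        finally show False using i by simp
      qed
    qed
  qed
  moreover have "Poly_Mapping.lookup (A i r c) 0 = 0" if "i \<ge> 1" for i r c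
  proof -
    have "i \<noteq> 0" using that by simp
    then obtain j where i: "i = Suc j" by (cases i) auto
    show ?thesis
    proof (cases "A i r c = 0")
      case False
      then have "m i c - m j r \<noteq> {}" using Asub[of j r c] i by auto
      then have "ind (m i c - m j r) \<noteq> 0" using keys_ind keys_eq_empty by metis
      then show ?thesis using i by (auto simp: A_def lookup_single when_def)
    qed simp
  qed
  ultimately show ?thesis unfolding minimal_graded_free_res_def by blast
qed

text \<open>\<open>Max\<close> bounds its members only over a finite set, and \<open>LEAST\<close>
  needs a witness; the finite length of the resolution supplies both.\<close>

lemma generator_bounds:
  assumes "graded_free_res I b d A" "c < b i"
  shows "d i c - int i \<le> res_reg b d" "i \<le> res_length b"
proof -
  have "\<exists>p. \<forall>i>p. b i = 0" using assms(1) unfolding graded_free_res_def by (elim conjE)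
  then obtain p where p: "\<forall>i>p. b i = 0" by blast
  have "finite {d i c - int i | i c. c < b i}"
  proof (rule finite_subset)
    show "{d i c - int i | i c. c < b i} \<subseteq> (\<Union>i\<le>p. (\<lambda>c. d i c - int i) ` {..<b i})"
    proof clarify
      fix i c assume c: "c < b i"
      then have "i \<le> p" using p by (metis not_le not_less_zero)
      then show "d i c - int i \<in> (\<Union>i\<le>p. (\<lambda>c. d i c - int i) ` {..<b i})" using c by blast
    qed
  qed simp
  then show "d i c - int i \<le> res_reg b d" unfolding res_reg_def using assms(2) by (intro Max_ge) auto
  have "\<forall>i>res_length b. b i = 0" unfolding res_length_def using p by (rule LeastI)
  then show "i \<le> res_length b" using assms(2) by (metis not_less gr_implies_not0)
qed

theorem theorem2p5:
  fixes E :: "'v::finite set set"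
  assumes "forest E"
  shows "reg_quot (NI E :: ('v, 'k::field) mpoly set) \<ge> int (matching_number E)
       \<and> proj_dim_quot (NI E :: ('v, 'k) mpoly set) \<ge> matching_number E"
proof -
  let ?I = "NI E :: ('v, 'k) mpoly set"
  obtain X y where K: "koenig_matching E X y" and X: "matching_number E \<le> card X"
    using koenig_matching_number[OF assms] .
  have bounds: "int (card X) \<le> res_reg b d \<and> card X \<le> res_length b"
    if res: "minimal_graded_free_res ?I b d A" for b d A
  proof -
    have "graded_free_res ?I b d A" using res by (simp add: minimal_graded_free_res_def)
    moreover from graded_free_res_NI_generator[OF K this]
    obtain c where "c < b (card X)" "d (card X) c = 2 * int (card X)" by blast
    ultimately show ?thesis using generator_bounds[of ?I b d A c "card X"] by simp
  qed
  have ex: "\<exists>b d A. minimal_graded_free_res ?I b d A" by (rule minimal_graded_free_res_NI_exists)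
  have "\<exists>b d A. minimal_graded_free_res ?I b d A \<and> reg_quot ?I = res_reg b d"
    unfolding reg_quot_def by (rule someI_ex) (use ex in blast)
  moreover have "\<exists>b d A. minimal_graded_free_res ?I b d A \<and> proj_dim_quot ?I = res_length b"
    unfolding proj_dim_quot_def by (rule someI_ex) (use ex in blast)
  ultimately have "int (card X) \<le> reg_quot ?I" "card X \<le> proj_dim_quot ?I" using bounds by metis+
  then show ?thesis using X by simp
qed

end
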